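(* Let $A$ and $B$ be finite dimensional unital associative algebras over a field $k$ of characteristic zero, let $\psi: B\otimes A \to A\otimes B$ be a factorisation of $A$ and $B$, and let $S_\psi=A\otimes_\psi B$ be the corresponding factorisation algebra. Then for every integer $n\ge 1$, $$S_\psi^{\otimes_B (n)} \cong A^{\otimes (n)}\otimes B$$ as $S_\psi$-$S_\psi$-bimodules, via the map $$\theta_n (a_1\otimes b_1 \otimes_B \cdots \otimes_B a_n\otimes b_n) = a_1\otimes a_{2_{\alpha_1}}\otimes \cdots \otimes a_{n_{\alpha_{n-1}}}\otimes \bigl(\cdots\bigl((b_1^{\alpha_1}b_2)^{\alpha_2}b_3\bigr)^{\alpha_3}\cdots\bigr)^{\alpha_{n-1}} b_n ,$$ whose inverse is $$\theta_n^{-1}(a_1\otimes\cdots\otimes a_n\otimes b)= a_1\otimes 1_B\otimes_B\cdots\otimes_B a_{n-1}\otimes 1_B\otimes_B a_n\otimes b .$$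
   Context: Unadorned $\otimes$ is over $k$. Write $\psi(b\otimes a)=a_\alpha\otimes b^\alpha$ (summation understood; further indices $\beta,\alpha_1,\alpha_2,\dots$ denote further applications of $\psi$). A linear map $\psi:B\otimes A\to A\otimes B$ is a factorisation of $A$ and $B$ if $\psi(1_B\otimes a)=a\otimes 1_B$, $\psi(b\otimes 1_A)=1_A\otimes b$, and $$(a d_\alpha)_\beta\otimes b^\beta c^\alpha = a_\beta d_\alpha\otimes (b^\beta c)^\alpha\qquad\text{for all } a,d\in A,\ b,c\in B.$$ The factorisation algebra $S_\psi=A\otimes_\psi B$ is the vector space $A\otimes B$ with the unital associative product $(a\otimes b)(c\otimes d)=a\,\psi(b\otimes c)\,d=ac_\alpha\otimes b^\alpha d$ and unit $1_A\otimes 1_B$. The algebras $A$ and $B$ are identified with the subalgebras $A\otimes 1_B$ and $1_A\otimes B$. $S_\psi^{\otimes_B(n)}=S_\psi\otimes_B\cdots\otimes_B S_\psi$ ($n$ factors) is an $S_\psi$-bimodule by multiplication on the outer factors: $$(a\otimes b)(a_1\otimes b_1\otimes_B\cdots\otimes_B a_n\otimes b_n)=aa_{1\alpha}\otimes b^\alpha b_1\otimes_B\cdots\otimes_B a_n\otimes b_n,$$ $$(a_1\otimes b_1\otimes_B\cdots\otimes_B a_n\otimes b_n)(c\otimes d)=a_1\otimes b_1\otimes_B\cdots\otimes_B a_nc_\alpha\otimes b_n^\alpha d.$$ In the formula for $\theta_n$, the elements of $B$ are moved successively to the right by $\psi$: put $c_1=b_1$; apply $\psi(c_i\otimes a_{i+1})=a_{(i+1)_{\alpha_i}}\otimes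 c_i^{\alpha_i}$ and set $c_{i+1}=c_i^{\alpha_i}b_{i+1}$ for $i=1,\dots,n-1$. The last tensor factor of $\theta_n$ is $c_n$, and $\theta_1$ is the identity. The $S_\psi$-bimodule structure on $A^{\otimes(n)}\otimes B$ is $$(a\otimes b)\cdot(a_1\otimes\cdots\otimes a_n\otimes c)=aa_{1_{\alpha_1}}\otimes a_{2_{\alpha_2}}\otimes\cdots\otimes a_{n_{\alpha_n}}\otimes \bigl(\cdots(b^{\alpha_1})^{\alpha_2}\cdots\bigr)^{\alpha_n}c,$$ $$(a_1\otimes\cdots\otimes a_n\otimes c)\cdot(a\otimes b)=a_1\otimes\cdots\otimes a_{n-1}\otimes a_na_\alpha\otimes c^\alpha b.$$ *)

theory Defs
  imports "Jordan_Normal_Form.Missing_VectorSpace" "HOL-Algebra.AbelCoset"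
begin

section \<open>Algebras and bimodules\<close>

text \<open>The locale \<^locale>\<open>algebra\<close> of HOL-Algebra is restricted to commutative algebras. As in
  \<^locale>\<open>ring\<close>, the zero algebra is not excluded.\<close>

locale unital_algebra = vectorspace K A + ring A for K and A +
  assumes smult_mult_left:
      "\<lbrakk>r \<in> carrier K; x \<in> carrier A; y \<in> carrier A\<rbrakk>
        \<Longrightarrow> (r \<odot>\<^bsub>A\<^esub> x) \<otimes>\<^bsub>A\<^esub> y = r \<odot>\<^bsub>A\<^esub> (x \<otimes>\<^bsub>A\<^esub> y)"
    and smult_mult_right:
      "\<lbrakk>r \<in> carrier K; x \<in> carrier A; y \<in> carrier A\<rbrakk>
        \<Longrightarrow> x \<otimes>\<^bsub>A\<^esub> (r \<odot>\<^bsub>A\<^esub> y) = r \<odot>\<^bsub>A\<^esub> (x \<otimes>\<^bsub>A\<^esub> y)"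

locale bimodule = S?: unital_algebra K S + M?: vectorspace K M for K and S and M +
  fixes lact and ract
  assumes lact_hom: "s \<in> carrier S \<Longrightarrow> lact s \<in> module_hom K M M"
    and lact_hom_scalar: "x \<in> carrier M \<Longrightarrow> (\<lambda>s. lact s x) \<in> module_hom K S M"
    and ract_hom: "s \<in> carrier S \<Longrightarrow> (\<lambda>x. ract x s) \<in> module_hom K M M"
    and ract_hom_scalar: "x \<in> carrier M \<Longrightarrow> ract x \<in> module_hom K S M"
    and lact_one: "x \<in> carrier M \<Longrightarrow> lact \<one>\<^bsub>S\<^esub> x = x"
    and ract_one: "x \<in> carrier M \<Longrightarrow> ract x \<one>\<^bsub>S\<^esub> = x"
    and lact_assoc: "\<lbrakk>s \<in> carrier S; t \<in> carrier S; x \<in> carrier M\<rbrakk>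
        \<Longrightarrow> lact (s \<otimes>\<^bsub>S\<^esub> t) x = lact s (lact t x)"
    and ract_assoc: "\<lbrakk>s \<in> carrier S; t \<in> carrier S; x \<in> carrier M\<rbrakk>
        \<Longrightarrow> ract x (s \<otimes>\<^bsub>S\<^esub> t) = ract (ract x s) t"
    and lact_ract: "\<lbrakk>s \<in> carrier S; t \<in> carrier S; x \<in> carrier M\<rbrakk>
        \<Longrightarrow> ract (lact s x) t = lact s (ract x t)"

locale bimodule_iso =
  M: bimodule K S M lactM ractM + N: bimodule K S N lactN ractN + linear_map K M N f
  for K and S and M and lactM and ractM and N and lactN and ractN and f +
  assumes bij: "bij_betw f (carrier M) (carrier N)"
    and f_lact: "\<lbrakk>s \<in> carrier S; x \<in> carrier M\<rbrakk> \<Longrightarrow> f (lactM s x) = lactN s (f x)"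
    and f_ract: "\<lbrakk>s \<in> carrier S; x \<in> carrier M\<rbrakk> \<Longrightarrow> f (ractM x s) = ractN (f x) s"


section \<open>Vector spaces presented by generators and relations\<close>

definition free_space ::
    "('k, 'r) ring_scheme \<Rightarrow> 'x set \<Rightarrow> ('k, 'x \<Rightarrow> 'k) module" where
  "free_space K X = (ring.func_space K X)
     \<lparr>carrier := {p \<in> X \<rightarrow>\<^sub>E carrier K. finite {x \<in> X. p x \<noteq> \<zero>\<^bsub>K\<^esub>}}\<rparr>"

definition basis_elem :: "('k, 'r) ring_scheme \<Rightarrow> 'x set \<Rightarrow> 'x \<Rightarrow> 'x \<Rightarrow> 'k" where
  "basis_elem K X x = restrict (\<lambda>y. if y = x then \<one>\<^bsub>K\<^esub> else \<zero>\<^bsub>K\<^esub>) X"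

text \<open>The multiplicative fields of a vector space carry no information and are left undefined.\<close>

definition quotient_space ::
    "('k, 'r) ring_scheme \<Rightarrow> ('k, 'v, 's) module_scheme \<Rightarrow> 'v set \<Rightarrow> ('k, 'v set) module" where
  "quotient_space K V W =
     \<lparr>carrier = a_rcosets\<^bsub>V\<^esub> W, mult = undefined, one = undefined,
      zero = W, add = set_add V, smult = (\<lambda>r C. \<Union>v\<in>C. W +>\<^bsub>V\<^esub> (r \<odot>\<^bsub>V\<^esub> v))\<rparr>"

definition presented ::
    "('k, 'r) ring_scheme \<Rightarrow> 'x set \<Rightarrow> ('x \<Rightarrow> 'k) set \<Rightarrow> ('k, ('x \<Rightarrow> 'k) set) module" where
  "presented K X R = quotient_space K (free_space K X) (module.span K (free_space K X) R)"

definition gen_class ::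
    "('k, 'r) ring_scheme \<Rightarrow> 'x set \<Rightarrow> ('x \<Rightarrow> 'k) set \<Rightarrow> 'x \<Rightarrow> ('x \<Rightarrow> 'k) set" where
  "gen_class K X R x = module.span K (free_space K X) R +>\<^bsub>free_space K X\<^esub> basis_elem K X x"

text \<open>The linear map from a space presented on the generators \<open>X\<close> to \<open>N\<close> with prescribed values
  \<open>f\<close> on the generators, computed on an arbitrary representative. It is independent of that
  representative as soon as \<open>f\<close> respects the relations; this is the case in all uses below when
  \<open>\<psi>\<close> is a factorisation and \<open>n \<ge> 1\<close>.\<close>

definition lin_ext ::
    "('k, 'r) ring_scheme \<Rightarrow> 'x set \<Rightarrow> ('k, 'n, 's) module_scheme \<Rightarrow> ('x \<Rightarrow> 'n)
      \<Rightarrow> ('x \<Rightarrow> 'k) set \<Rightarrow> 'n" where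
  "lin_ext K X N f t =
     (let p = (SOME p. p \<in> t) in \<Oplus>\<^bsub>N\<^esub>x\<in>{x \<in> X. p x \<noteq> \<zero>\<^bsub>K\<^esub>}. p x \<odot>\<^bsub>N\<^esub> f x)"

text \<open>The relations saying that for every slot \<open>j\<close> the map sending \<open>u\<close> in \<open>M\<close> to the class of
  the generator \<open>j u\<close> is linear. The slots of a tensor product are its arguments, each with the
  remaining arguments fixed.\<close>

definition slot_rels ::
    "('k, 'r) ring_scheme \<Rightarrow> 'x set \<Rightarrow> ('k, 'm, 's) module_scheme \<Rightarrow> ('m \<Rightarrow> 'x) set
      \<Rightarrow> ('x \<Rightarrow> 'k) set" where
  "slot_rels K X M J =
     {basis_elem K X (j (u \<oplus>\<^bsub>M\<^esub> v))
        \<ominus>\<^bsub>free_space K X\<^esub> (basis_elem K X (j u) \<oplus>\<^bsub>free_space K X\<^esub> basis_elem K X (j v))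
      | j u v. j \<in> J \<and> u \<in> carrier M \<and> v \<in> carrier M} \<union>
     {basis_elem K X (j (r \<odot>\<^bsub>M\<^esub> u))
        \<ominus>\<^bsub>free_space K X\<^esub> (r \<odot>\<^bsub>free_space K X\<^esub> basis_elem K X (j u))
      | j r u. j \<in> J \<and> r \<in> carrier K \<and> u \<in> carrier M}"


section \<open>Tensor products\<close>

definition tensor_rels ::
    "('k, 'r) ring_scheme \<Rightarrow> ('k, 'a, 's) module_scheme \<Rightarrow> ('k, 'b, 't) module_scheme
      \<Rightarrow> ('a \<times> 'b \<Rightarrow> 'k) set" where
  "tensor_rels K A B =
     slot_rels K (carrier A \<times> carrier B) A {\<lambda>a. (a, b) | b. b \<in> carrier B} \<union>
     slot_rels K (carrier A \<times> carrier B) B {\<lambda>b. (a, b) | a. a \<in> carrier A}"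

definition tensor ::
    "('k, 'r) ring_scheme \<Rightarrow> ('k, 'a, 's) module_scheme \<Rightarrow> ('k, 'b, 't) module_scheme
      \<Rightarrow> ('k, ('a \<times> 'b \<Rightarrow> 'k) set) module" where
  "tensor K A B = presented K (carrier A \<times> carrier B) (tensor_rels K A B)"

definition tens ::
    "('k, 'r) ring_scheme \<Rightarrow> ('k, 'a, 's) module_scheme \<Rightarrow> ('k, 'b, 't) module_scheme
      \<Rightarrow> 'a \<Rightarrow> 'b \<Rightarrow> ('a \<times> 'b \<Rightarrow> 'k) set" where
  "tens K A B a b = gen_class K (carrier A \<times> carrier B) (tensor_rels K A B) (a, b)"

definition tensor_ext ::
    "('k, 'r) ring_scheme \<Rightarrow> ('k, 'a, 's) module_scheme \<Rightarrow> ('k, 'b, 't) module_scheme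
      \<Rightarrow> ('k, 'n, 'u) module_scheme \<Rightarrow> ('a \<Rightarrow> 'b \<Rightarrow> 'n) \<Rightarrow> ('a \<times> 'b \<Rightarrow> 'k) set \<Rightarrow> 'n" where
  "tensor_ext K A B N f = lin_ext K (carrier A \<times> carrier B) N (\<lambda>(a, b). f a b)"

definition tuples :: "('a, 's) ring_scheme \<Rightarrow> nat \<Rightarrow> 'a list set" where
  "tuples A n = {xs. set xs \<subseteq> carrier A \<and> length xs = n}"

text \<open>The space \<open>M \<otimes>\<^bsub>B\<^esub> \<dots> \<otimes>\<^bsub>B\<^esub> M\<close> with \<open>n\<close> factors, where \<open>B\<close> acts on \<open>M\<close> by \<open>rB\<close> from the
  right and by \<open>lB\<close> from the left.\<close>

definition tensor_power_over_rels ::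
    "('k, 'r) ring_scheme \<Rightarrow> 'b set \<Rightarrow> ('k, 'm, 's) module_scheme
      \<Rightarrow> ('m \<Rightarrow> 'b \<Rightarrow> 'm) \<Rightarrow> ('b \<Rightarrow> 'm \<Rightarrow> 'm) \<Rightarrow> nat \<Rightarrow> ('m list \<Rightarrow> 'k) set" where
  "tensor_power_over_rels K B M rB lB n =
     slot_rels K (tuples M n) M {\<lambda>x. xs[i := x] | xs i. xs \<in> tuples M n \<and> i < n} \<union>
     {basis_elem K (tuples M n) (xs[i := rB (xs ! i) b])
        \<ominus>\<^bsub>free_space K (tuples M n)\<^esub> basis_elem K (tuples M n) (xs[Suc i := lB b (xs ! Suc i)])
      | xs i b. xs \<in> tuples M n \<and> Suc i < n \<and> b \<in> B}"

text \<open>The space \<open>A \<otimes> \<dots> \<otimes> A \<otimes> B\<close> over \<open>K\<close>, with \<open>n\<close> factors \<open>A\<close>.\<close>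

definition tensor_power_times_rels ::
    "('k, 'r) ring_scheme \<Rightarrow> ('k, 'a, 's) module_scheme \<Rightarrow> ('k, 'b, 't) module_scheme \<Rightarrow> nat
      \<Rightarrow> ('a list \<times> 'b \<Rightarrow> 'k) set" where
  "tensor_power_times_rels K A B n =
     slot_rels K (tuples A n \<times> carrier B) A
       {\<lambda>a. (as[i := a], b) | as i b. as \<in> tuples A n \<and> i < n \<and> b \<in> carrier B} \<union>
     slot_rels K (tuples A n \<times> carrier B) B {\<lambda>b. (as, b) | as. as \<in> tuples A n}"


section \<open>Factorisations and the two bimodules\<close>

text \<open>In Sweedler notation \<open>\<psi>(b \<otimes> a) = a\<^sub>\<alpha> \<otimes> b\<^sup>\<alpha>\<close>, the sum \<open>f(a\<^sub>\<alpha>, b\<^sup>\<alpha>)\<close> is the value at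
  \<open>\<psi>(b \<otimes> a)\<close> of the linear extension of \<open>f\<close> to \<open>A \<otimes> B\<close>; below this is \<open>sweedler N f b a\<close>,
  with \<open>N\<close> the space in which \<open>f\<close> takes its values.\<close>

locale factorisation_data =
  fixes K :: "('k, 'r) ring_scheme"
    and A :: "('k, 'a, 's) module_scheme"
    and B :: "('k, 'b, 't) module_scheme"
    and \<psi> :: "('b \<times> 'a \<Rightarrow> 'k) set \<Rightarrow> ('a \<times> 'b \<Rightarrow> 'k) set"
begin

definition sweedler ::
    "('k, 'n, 'u) module_scheme \<Rightarrow> ('a \<Rightarrow> 'b \<Rightarrow> 'n) \<Rightarrow> 'b \<Rightarrow> 'a \<Rightarrow> 'n" where
  "sweedler N f b a = tensor_ext K A B N f (\<psi> (tens K B A b a))"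

definition factorisation :: bool where
  "factorisation \<longleftrightarrow>
     \<psi> \<in> module_hom K (tensor K B A) (tensor K A B) \<and>
     (\<forall>a\<in>carrier A. \<psi> (tens K B A \<one>\<^bsub>B\<^esub> a) = tens K A B a \<one>\<^bsub>B\<^esub>) \<and>
     (\<forall>b\<in>carrier B. \<psi> (tens K B A b \<one>\<^bsub>A\<^esub>) = tens K A B \<one>\<^bsub>A\<^esub> b) \<and>
     (\<forall>a\<in>carrier A. \<forall>d\<in>carrier A. \<forall>b\<in>carrier B. \<forall>c\<in>carrier B.
        sweedler (tensor K A B)
          (\<lambda>d\<^sub>\<alpha> c\<^sub>\<alpha>. sweedler (tensor K A B) (\<lambda>e\<^sub>\<beta> b\<^sub>\<beta>. tens K A B e\<^sub>\<beta> (b\<^sub>\<beta> \<otimes>\<^bsub>B\<^esub> c\<^sub>\<alpha>)) b (a \<otimes>\<^bsub>A\<^esub> d\<^sub>\<alpha>))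
          c d =
        sweedler (tensor K A B)
          (\<lambda>a\<^sub>\<beta> b\<^sub>\<beta>. sweedler (tensor K A B) (\<lambda>d\<^sub>\<alpha> e\<^sub>\<alpha>. tens K A B (a\<^sub>\<beta> \<otimes>\<^bsub>A\<^esub> d\<^sub>\<alpha>) e\<^sub>\<alpha>) (b\<^sub>\<beta> \<otimes>\<^bsub>B\<^esub> c) d)
          b a)"

definition fact_alg :: "('k, ('a \<times> 'b \<Rightarrow> 'k) set) module" where
  "fact_alg = (tensor K A B)
     \<lparr>mult := (\<lambda>s t.
        tensor_ext K A B (tensor K A B) (\<lambda>a b.
          tensor_ext K A B (tensor K A B) (\<lambda>c d.
            sweedler (tensor K A B) (\<lambda>c\<^sub>\<alpha> b\<^sub>\<alpha>. tens K A B (a \<otimes>\<^bsub>A\<^esub> c\<^sub>\<alpha>) (b\<^sub>\<alpha> \<otimes>\<^bsub>B\<^esub> d)) b c) t) s),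
      one := tens K A B \<one>\<^bsub>A\<^esub> \<one>\<^bsub>B\<^esub>\<rparr>"

text \<open>\<open>B\<close> acts on the factorisation algebra through its identification with \<open>1 \<otimes> B\<close>.\<close>

definition fact_power_rels :: "nat \<Rightarrow> (('a \<times> 'b \<Rightarrow> 'k) set list \<Rightarrow> 'k) set" where
  "fact_power_rels n = tensor_power_over_rels K (carrier B) fact_alg
     (\<lambda>s b. s \<otimes>\<^bsub>fact_alg\<^esub> tens K A B \<one>\<^bsub>A\<^esub> b) (\<lambda>b s. tens K A B \<one>\<^bsub>A\<^esub> b \<otimes>\<^bsub>fact_alg\<^esub> s) n"

definition fact_power ::
    "nat \<Rightarrow> ('k, (('a \<times> 'b \<Rightarrow> 'k) set list \<Rightarrow> 'k) set) module" where
  "fact_power n = presented K (tuples fact_alg n) (fact_power_rels n)"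

definition fact_power_tens ::
    "nat \<Rightarrow> ('a \<times> 'b \<Rightarrow> 'k) set list \<Rightarrow> (('a \<times> 'b \<Rightarrow> 'k) set list \<Rightarrow> 'k) set" where
  "fact_power_tens n = gen_class K (tuples fact_alg n) (fact_power_rels n)"

definition fact_power_lact ::
    "nat \<Rightarrow> ('a \<times> 'b \<Rightarrow> 'k) set \<Rightarrow> (('a \<times> 'b \<Rightarrow> 'k) set list \<Rightarrow> 'k) set
      \<Rightarrow> (('a \<times> 'b \<Rightarrow> 'k) set list \<Rightarrow> 'k) set" where
  "fact_power_lact n s = lin_ext K (tuples fact_alg n) (fact_power n)
     (\<lambda>xs. fact_power_tens n (xs[0 := s \<otimes>\<^bsub>fact_alg\<^esub> (xs ! 0)]))"

definition fact_power_ract ::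
    "nat \<Rightarrow> (('a \<times> 'b \<Rightarrow> 'k) set list \<Rightarrow> 'k) set \<Rightarrow> ('a \<times> 'b \<Rightarrow> 'k) set
      \<Rightarrow> (('a \<times> 'b \<Rightarrow> 'k) set list \<Rightarrow> 'k) set" where
  "fact_power_ract n x s = lin_ext K (tuples fact_alg n) (fact_power n)
     (\<lambda>xs. fact_power_tens n (xs[n - 1 := (xs ! (n - 1)) \<otimes>\<^bsub>fact_alg\<^esub> s])) x"

definition power_times ::
    "nat \<Rightarrow> ('k, ('a list \<times> 'b \<Rightarrow> 'k) set) module" where
  "power_times n = presented K (tuples A n \<times> carrier B) (tensor_power_times_rels K A B n)"

definition power_times_tens :: "nat \<Rightarrow> 'a list \<Rightarrow> 'b \<Rightarrow> ('a list \<times> 'b \<Rightarrow> 'k) set" where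
  "power_times_tens n as b =
     gen_class K (tuples A n \<times> carrier B) (tensor_power_times_rels K A B n) (as, b)"

text \<open>\<open>push n as b [x\<^sub>1, \<dots>, x\<^sub>m] c\<close> moves \<open>b\<close> to the right past \<open>x\<^sub>1, \<dots>, x\<^sub>m\<close>, giving
  \<open>as \<otimes> x\<^sub>1\<^sub>\<alpha>\<^sub>1 \<otimes> \<dots> \<otimes> x\<^sub>m\<^sub>\<alpha>\<^sub>m \<otimes> (\<dots>(b\<^sup>\<alpha>\<^sup>1)\<dots>)\<^sup>\<alpha>\<^sup>m c\<close>; it is used with \<open>n = length as + m\<close>.\<close>

primrec push ::
    "nat \<Rightarrow> 'a list \<Rightarrow> 'b \<Rightarrow> 'a list \<Rightarrow> 'b \<Rightarrow> ('a list \<times> 'b \<Rightarrow> 'k) set" where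
  "push n as b [] c = power_times_tens n as (b \<otimes>\<^bsub>B\<^esub> c)"
| "push n as b (x # xs) c =
     sweedler (power_times n) (\<lambda>x\<^sub>\<alpha> b\<^sub>\<alpha>. push n (as @ [x\<^sub>\<alpha>]) b\<^sub>\<alpha> xs c) b x"

definition power_times_lact ::
    "nat \<Rightarrow> ('a \<times> 'b \<Rightarrow> 'k) set \<Rightarrow> ('a list \<times> 'b \<Rightarrow> 'k) set
      \<Rightarrow> ('a list \<times> 'b \<Rightarrow> 'k) set" where
  "power_times_lact n s x =
     tensor_ext K A B (power_times n) (\<lambda>a b.
       lin_ext K (tuples A n \<times> carrier B) (power_times n) (\<lambda>(as, c).
         sweedler (power_times n) (\<lambda>x\<^sub>\<alpha> b\<^sub>\<alpha>. push n [a \<otimes>\<^bsub>A\<^esub> x\<^sub>\<alpha>] b\<^sub>\<alpha> (tl as) c) b (hd as)) x) s"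

definition power_times_ract ::
    "nat \<Rightarrow> ('a list \<times> 'b \<Rightarrow> 'k) set \<Rightarrow> ('a \<times> 'b \<Rightarrow> 'k) set
      \<Rightarrow> ('a list \<times> 'b \<Rightarrow> 'k) set" where
  "power_times_ract n x s =
     tensor_ext K A B (power_times n) (\<lambda>a b.
       lin_ext K (tuples A n \<times> carrier B) (power_times n) (\<lambda>(as, c).
         sweedler (power_times n)
           (\<lambda>a\<^sub>\<alpha> c\<^sub>\<alpha>. power_times_tens n (as[n - 1 := (as ! (n - 1)) \<otimes>\<^bsub>A\<^esub> a\<^sub>\<alpha>]) (c\<^sub>\<alpha> \<otimes>\<^bsub>B\<^esub> b)) c a) x) s"

text \<open>\<open>theta_step n as c [(a\<^sub>i\<^sub>+\<^sub>1, b\<^sub>i\<^sub>+\<^sub>1), \<dots>]\<close> is the state of the computation of the value of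
  \<open>\<theta>\<^sub>n\<close> after \<open>i = length as\<close> factors, where \<open>c\<close> stands for \<open>c\<^sub>i\<close>, with
  \<open>c\<^sub>i\<^sub>+\<^sub>1 = c\<^sub>i\<^sup>\<alpha> b\<^sub>i\<^sub>+\<^sub>1\<close>.\<close>

primrec theta_step ::
    "nat \<Rightarrow> 'a list \<Rightarrow> 'b \<Rightarrow> ('a \<times> 'b) list \<Rightarrow> ('a list \<times> 'b \<Rightarrow> 'k) set" where
  "theta_step n as c [] = power_times_tens n as c"
| "theta_step n as c (ab # ps) =
     sweedler (power_times n)
       (\<lambda>a\<^sub>\<alpha> c\<^sub>\<alpha>. theta_step n (as @ [a\<^sub>\<alpha>]) (c\<^sub>\<alpha> \<otimes>\<^bsub>B\<^esub> snd ab) ps) c (fst ab)"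

definition theta_val :: "('a \<times> 'b) list \<Rightarrow> ('a list \<times> 'b \<Rightarrow> 'k) set" where
  "theta_val ps = theta_step (length ps) [fst (hd ps)] (snd (hd ps)) (tl ps)"

end

end

theory Submission
  imports Defs
begin

text \<open>
  Write \<open>S\<close> for the factorisation algebra. In \<open>S \<otimes>\<^bsub>B\<^esub> \<dots> \<otimes>\<^bsub>B\<^esub> S\<close> a pure tensor \<open>a \<otimes> b\<close> of \<open>S\<close> is the
  product \<open>(a \<otimes> 1)(1 \<otimes> b)\<close>, so \<open>b\<close> can be handed over to the next factor. Doing this from left to
  right, every element of the tensor power becomes a sum of terms
  \<open>(a\<^sub>1 \<otimes> 1) \<otimes>\<^bsub>B\<^esub> \<dots> \<otimes>\<^bsub>B\<^esub> (a\<^sub>n\<^sub>-\<^sub>1 \<otimes> 1) \<otimes>\<^bsub>B\<^esub> (a\<^sub>n \<otimes> b)\<close>, and the theorem says that this normal form is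
  unique. The map \<open>\<theta>\<close> computes the normal form; its inverse, called \<open>\<phi>\<close> here, reads it as a tensor.

  The proof is organised so that as few maps as possible have to be shown to be well defined. The
  linear extension \<open>lin_ext\<close> of a function on generators evaluates a linear combination on a chosen
  representative. Such a combination commutes with every linear map (\<open>lin_ext_commute\<close>) and is
  linear in any parameter in which the function is linear (\<open>lin_ext_param\<close>); both hold for arbitrary
  functions on the generators. Hence all formulas involving Sweedler sums in
  \<open>A \<otimes> \<dots> \<otimes> A \<otimes> B\<close> can be pushed through \<open>\<phi>\<close> directly. Once in the tensor power, a Sweedler sum of a linear function of \<open>S\<close> is the value of that function at a product
  of \<open>S\<close> (\<open>sweedler_hom_inB\<close>, \<open>sweedler_hom_mult\<close>), and the relations over \<open>B\<close> do the rest
  (\<open>ten_move_right\<close>). In this way \<open>phi_theta_val\<close> shows that \<open>\<phi>\<close> maps the given formula for \<open>\<theta>\<close> to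
  the original tensor, and \<open>phi_lact\<close> and \<open>phi_ract\<close> show that \<open>\<phi>\<close> intertwines the actions.

  The remaining point is that \<open>\<phi>\<close> is bijective. For this \<open>\<theta>\<close> is constructed on the tensor power, where
  the relations must be checked. The recursion \<open>spread\<close> is phrased in terms of
  the product of \<open>S\<close>: it splits the first factor as \<open>\<Sum> a \<otimes> c\<close>, records \<open>a\<close>, and multiplies the next
  factor by \<open>1 \<otimes> c\<close> from the left. Multilinearity follows by induction, and compatibility with the
  relations over \<open>B\<close> is associativity of \<open>S\<close> (\<open>mult_assoc_S\<close>), which is the content of the
  factorisation axiom. Then \<open>\<phi> \<circ> \<theta>\<close> and \<open>\<theta> \<circ> \<phi>\<close> fix the generators. The bimodule axioms hold in
  the tensor power because \<open>S\<close> is associative (\<open>bimodule_M\<close>), and they are transported along the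
  bijection to \<open>A \<otimes> \<dots> \<otimes> A \<otimes> B\<close> (\<open>bimodule_iso_transport\<close>).
\<close>

section \<open>Linear maps\<close>

lemma module_homI:
  assumes "\<And>x. x \<in> carrier M \<Longrightarrow> f x \<in> carrier N"
    and "\<And>x y. \<lbrakk>x \<in> carrier M; y \<in> carrier M\<rbrakk> \<Longrightarrow> f (x \<oplus>\<^bsub>M\<^esub> y) = f x \<oplus>\<^bsub>N\<^esub> f y"
    and "\<And>r x. \<lbrakk>r \<in> carrier K; x \<in> carrier M\<rbrakk> \<Longrightarrow> f (r \<odot>\<^bsub>M\<^esub> x) = r \<odot>\<^bsub>N\<^esub> f x"
  shows "f \<in> module_hom K M N"
  using assms by (auto simp: module_hom_def)

lemma module_hom_in: "\<lbrakk>f \<in> module_hom K M N; x \<in> carrier M\<rbrakk> \<Longrightarrow> f x \<in> carrier N"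
  using module_hom_closed by blast

lemma module_hom_comp:
  assumes "f \<in> module_hom K M N" "g \<in> module_hom K N P"
  shows "(\<lambda>x. g (f x)) \<in> module_hom K M P"
  using assms by (auto simp: module_hom_def Pi_iff)

lemma module_hom_cong:
  assumes "module K M" "f \<in> module_hom K M N" "\<And>x. x \<in> carrier M \<Longrightarrow> g x = f x"
  shows "g \<in> module_hom K M N"
proof -
  interpret M: module K M by fact
  show ?thesis using assms(2,3) by (auto simp: module_hom_def Pi_iff)
qed

lemma module_hom_finsum:
  assumes "module K M" "module K N" "h \<in> module_hom K M N" "g \<in> I \<rightarrow> carrier M"
  shows "h (\<Oplus>\<^bsub>M\<^esub>i\<in>I. g i) = (\<Oplus>\<^bsub>N\<^esub>i\<in>I. h (g i))"
proof -
  interpret N: module K N by fact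
  interpret h: mod_hom K M N h using assms by (intro mod_hom.intro mod_hom_axioms.intro)
  show ?thesis using assms(4)
  proof (induct I rule: infinite_finite_induct)
    case (insert i I)
    have "(\<Oplus>\<^bsub>N\<^esub>i\<in>insert i I. h (g i)) = h (g i) \<oplus>\<^bsub>N\<^esub> (\<Oplus>\<^bsub>N\<^esub>i\<in>I. h (g i))"
      using insert by (intro N.finsum_insert) auto
    with insert show ?case by simp
  qed auto
qed

lemma smult_module_hom:
  assumes "module K N" "r \<in> carrier K"
  shows "(\<lambda>x. r \<odot>\<^bsub>N\<^esub> x) \<in> module_hom K N N"
proof -
  interpret N: module K N by fact
  show ?thesis using assms(2)
    by (intro module_homI) (simp_all add: N.smult_r_distr N.smult_assoc1[symmetric] N.R.m_comm)
qed

lemma finsum_module_hom: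
  assumes N: "module K N" and h: "\<And>i. i \<in> I \<Longrightarrow> (\<lambda>u. f u i) \<in> module_hom K U N" "finite I"
  shows "(\<lambda>u. \<Oplus>\<^bsub>N\<^esub>i\<in>I. f u i) \<in> module_hom K U N"
proof (rule module_homI)
  interpret N: module K N by fact
  show "(\<Oplus>\<^bsub>N\<^esub>i\<in>I. f u i) \<in> carrier N" if "u \<in> carrier U" for u
    using h(1) that by (intro N.finsum_closed) (auto dest: module_hom_in)
  show "(\<Oplus>\<^bsub>N\<^esub>i\<in>I. f (u \<oplus>\<^bsub>U\<^esub> v) i) = (\<Oplus>\<^bsub>N\<^esub>i\<in>I. f u i) \<oplus>\<^bsub>N\<^esub> (\<Oplus>\<^bsub>N\<^esub>i\<in>I. f v i)"
    if "u \<in> carrier U" "v \<in> carrier U" for u v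
  proof -
    have c: "(\<lambda>i. f w i) \<in> I \<rightarrow> carrier N" if "w \<in> carrier U" for w
      using module_hom_in[OF h(1)] that by auto
    have "(\<Oplus>\<^bsub>N\<^esub>i\<in>I. f (u \<oplus>\<^bsub>U\<^esub> v) i) = (\<Oplus>\<^bsub>N\<^esub>i\<in>I. f u i \<oplus>\<^bsub>N\<^esub> f v i)"
      using c[OF that(1)] c[OF that(2)] module_hom_add[OF h(1) that]
      by (intro N.finsum_cong') (auto simp: Pi_iff)
    then show ?thesis using c that by (simp add: N.finsum_addf)
  qed
  show "(\<Oplus>\<^bsub>N\<^esub>i\<in>I. f (r \<odot>\<^bsub>U\<^esub> u) i) = r \<odot>\<^bsub>N\<^esub> (\<Oplus>\<^bsub>N\<^esub>i\<in>I. f u i)"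
    if "r \<in> carrier K" "u \<in> carrier U" for r u
  proof -
    have c: "(\<lambda>i. f u i) \<in> I \<rightarrow> carrier N" using module_hom_in[OF h(1)] that by auto
    have "(\<Oplus>\<^bsub>N\<^esub>i\<in>I. f (r \<odot>\<^bsub>U\<^esub> u) i) = (\<Oplus>\<^bsub>N\<^esub>i\<in>I. r \<odot>\<^bsub>N\<^esub> f u i)"
      using c that module_hom_smult[OF h(1) that] by (intro N.finsum_cong') (auto simp: Pi_iff)
    then show ?thesis using c that h(2) by (simp add: N.finsum_smult_ldistr)
  qed
qed

section \<open>Spaces given by generators and relations\<close>

text \<open>The part of \<open>lin_ext\<close> that comes after the choice of a representative.\<close>

definition lin_sum ::
    "('k, 'r) ring_scheme \<Rightarrow> 'x set \<Rightarrow> ('k, 'n, 's) module_scheme \<Rightarrow> ('x \<Rightarrow> 'n)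
      \<Rightarrow> ('x \<Rightarrow> 'k) \<Rightarrow> 'n" where
  "lin_sum K X N f p = (\<Oplus>\<^bsub>N\<^esub>x\<in>{x \<in> X. p x \<noteq> \<zero>\<^bsub>K\<^esub>}. p x \<odot>\<^bsub>N\<^esub> f x)"

lemma lin_ext_eq: "lin_ext K X N f t = lin_sum K X N f (SOME p. p \<in> t)"
  by (simp add: lin_ext_def lin_sum_def Let_def)

text \<open>A presentation without relations. It is a locale of its own because the relations of a
  \<open>presentation\<close> are required to lie in the free space, and proving this needs facts about the
  free space.\<close>

locale free_presentation = field K
  for K :: "('k, 'r) ring_scheme" and X :: "'x set"
begin

abbreviation "F \<equiv> free_space K X"

lemma carrier_F: "carrier F = {p \<in> X \<rightarrow>\<^sub>E carrier K. finite {x \<in> X. p x \<noteq> \<zero>\<^bsub>K\<^esub>}}"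
  by (simp add: free_space_def)

lemma F_ops:
  "p \<oplus>\<^bsub>F\<^esub> q = restrict (\<lambda>x. p x \<oplus>\<^bsub>K\<^esub> q x) X"
  "r \<odot>\<^bsub>F\<^esub> p = restrict (\<lambda>x. r \<otimes>\<^bsub>K\<^esub> p x) X"
  "\<zero>\<^bsub>F\<^esub> = restrict (\<lambda>x. \<zero>\<^bsub>K\<^esub>) X"
  by (simp_all add: free_space_def func_space_def)

lemma module_F: "module K F"
proof -
  interpret f: module K "func_space X" by (rule func_space_is_module)
  have in_F: "restrict g X \<in> carrier F"
    if "\<And>x. x \<in> X \<Longrightarrow> g x \<in> carrier K" "finite J" "\<And>x. \<lbrakk>x \<in> X; g x \<noteq> \<zero>\<^bsub>K\<^esub>\<rbrakk> \<Longrightarrow> x \<in> J" for g J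
    unfolding carrier_F using that(1,3) by (auto intro: finite_subset[OF _ that(2)])
  have supp: "finite {x \<in> X. p x \<noteq> \<zero>\<^bsub>K\<^esub>}" "\<And>x. x \<in> X \<Longrightarrow> p x \<in> carrier K"
    if "p \<in> carrier F" for p using that by (auto simp: carrier_F)
  have sub: "LinearCombinations.submodule K (carrier F) (func_space X)"
  proof (unfold_locales)
    show "carrier F \<subseteq> carrier (func_space X)" by (auto simp: carrier_F func_space_def)
    fix p q assume p: "p \<in> carrier F" and q: "q \<in> carrier F"
    show "p \<oplus>\<^bsub>func_space X\<^esub> q \<in> carrier F"
      unfolding func_space_def ring_record_simps
      using supp[OF p] supp[OF q]
      by (intro in_F[of _ "{x \<in> X. p x \<noteq> \<zero>\<^bsub>K\<^esub>} \<union> {x \<in> X. q x \<noteq> \<zero>\<^bsub>K\<^esub>}"]) auto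
  next
    show "\<zero>\<^bsub>func_space X\<^esub> \<in> carrier F"
      unfolding func_space_def ring_record_simps by (intro in_F[of _ "{}"]) auto
  next
    fix r p assume r: "r \<in> carrier K" and p: "p \<in> carrier F"
    show "r \<odot>\<^bsub>func_space X\<^esub> p \<in> carrier F"
      unfolding func_space_def module.simps
      using supp[OF p] r by (intro in_F[of _ "{x \<in> X. p x \<noteq> \<zero>\<^bsub>K\<^esub>}"]) auto
  qed
  have "F = func_space X\<lparr>carrier := carrier F\<rparr>" by (simp add: free_space_def)
  with f.submodule_is_module[OF sub] show ?thesis by simp
qed

sublocale F: module K F by (rule module_F)

lemma basis_closed: "x \<in> X \<Longrightarrow> basis_elem K X x \<in> carrier F"
  by (auto simp: carrier_F basis_elem_def intro!: finite_subset[of _ "{x}"] split: if_splits)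

lemma coeff_closed: "\<lbrakk>p \<in> carrier F; x \<in> X\<rbrakk> \<Longrightarrow> p x \<in> carrier K"
  by (auto simp: carrier_F)

text \<open>Sums over different supports cannot be compared directly, so they are first extended to a
  common finite index set.\<close>

lemma lin_sum_superset:
  assumes N: "module K N" and f: "f \<in> X \<rightarrow> carrier N" and p: "p \<in> carrier F"
    and J: "finite J" "{x \<in> X. p x \<noteq> \<zero>\<^bsub>K\<^esub>} \<subseteq> J" "J \<subseteq> X"
  shows "lin_sum K X N f p = (\<Oplus>\<^bsub>N\<^esub>x\<in>J. p x \<odot>\<^bsub>N\<^esub> f x)"
proof -
  interpret N: module K N by fact
  show ?thesis unfolding lin_sum_def using f p J
    by (intro N.add.finprod_mono_neutral_cong_left) (auto simp: coeff_closed Pi_iff)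
qed

lemma lin_sum_closed:
  assumes N: "module K N" and f: "f \<in> X \<rightarrow> carrier N" and p: "p \<in> carrier F"
  shows "lin_sum K X N f p \<in> carrier N"
proof -
  interpret N: module K N by fact
  show ?thesis unfolding lin_sum_def using f p
    by (intro N.finsum_closed) (auto simp: coeff_closed)
qed

lemma lin_sum_hom:
  assumes N: "module K N" and f: "f \<in> X \<rightarrow> carrier N"
  shows "lin_sum K X N f \<in> module_hom K F N"
proof (rule module_homI)
  interpret N: module K N by fact
  show "lin_sum K X N f p \<in> carrier N" if "p \<in> carrier F" for p
    using lin_sum_closed[OF N f that] .
  show "lin_sum K X N f (p \<oplus>\<^bsub>F\<^esub> q) = lin_sum K X N f p \<oplus>\<^bsub>N\<^esub> lin_sum K X N f q"
    if p: "p \<in> carrier F" and q: "q \<in> carrier F" for p q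
  proof -
    let ?J = "{x \<in> X. p x \<noteq> \<zero>\<^bsub>K\<^esub>} \<union> {x \<in> X. q x \<noteq> \<zero>\<^bsub>K\<^esub>}"
    have J: "finite ?J" "?J \<subseteq> X" using p q by (auto simp: carrier_F)
    have s: "{x \<in> X. (p \<oplus>\<^bsub>F\<^esub> q) x \<noteq> \<zero>\<^bsub>K\<^esub>} \<subseteq> ?J" by (auto simp: F_ops)
    have "lin_sum K X N f (p \<oplus>\<^bsub>F\<^esub> q) = (\<Oplus>\<^bsub>N\<^esub>x\<in>?J. (p \<oplus>\<^bsub>F\<^esub> q) x \<odot>\<^bsub>N\<^esub> f x)"
      using lin_sum_superset[OF N f F.a_closed[OF p q] J(1) s J(2)] .
    also have "\<dots> = (\<Oplus>\<^bsub>N\<^esub>x\<in>?J. p x \<odot>\<^bsub>N\<^esub> f x \<oplus>\<^bsub>N\<^esub> q x \<odot>\<^bsub>N\<^esub> f x)"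
      using f coeff_closed[OF p] coeff_closed[OF q]
      by (intro N.finsum_cong') (auto simp: F_ops N.smult_l_distr Pi_iff)
    also have "\<dots> = (\<Oplus>\<^bsub>N\<^esub>x\<in>?J. p x \<odot>\<^bsub>N\<^esub> f x) \<oplus>\<^bsub>N\<^esub> (\<Oplus>\<^bsub>N\<^esub>x\<in>?J. q x \<odot>\<^bsub>N\<^esub> f x)"
      using f coeff_closed[OF p] coeff_closed[OF q] by (intro N.finsum_addf) auto
    also have "\<dots> = lin_sum K X N f p \<oplus>\<^bsub>N\<^esub> lin_sum K X N f q"
      using lin_sum_superset[OF N f p J(1) _ J(2)] lin_sum_superset[OF N f q J(1) _ J(2)] by auto
    finally show ?thesis .
  qed
  show "lin_sum K X N f (r \<odot>\<^bsub>F\<^esub> p) = r \<odot>\<^bsub>N\<^esub> lin_sum K X N f p"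
    if r: "r \<in> carrier K" and p: "p \<in> carrier F" for r p
  proof -
    let ?J = "{x \<in> X. p x \<noteq> \<zero>\<^bsub>K\<^esub>}"
    have J: "finite ?J" "?J \<subseteq> X" using p by (auto simp: carrier_F)
    have s: "{x \<in> X. (r \<odot>\<^bsub>F\<^esub> p) x \<noteq> \<zero>\<^bsub>K\<^esub>} \<subseteq> ?J" using r by (auto simp: F_ops)
    have "lin_sum K X N f (r \<odot>\<^bsub>F\<^esub> p) = (\<Oplus>\<^bsub>N\<^esub>x\<in>?J. (r \<odot>\<^bsub>F\<^esub> p) x \<odot>\<^bsub>N\<^esub> f x)"
      using lin_sum_superset[OF N f F.smult_closed[OF r p] J(1) s J(2)] .
    also have "\<dots> = (\<Oplus>\<^bsub>N\<^esub>x\<in>?J. r \<odot>\<^bsub>N\<^esub> (p x \<odot>\<^bsub>N\<^esub> f x))"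
      using f coeff_closed[OF p] r
      by (intro N.finsum_cong') (auto simp: F_ops N.smult_assoc1 Pi_iff)
    also have "\<dots> = r \<odot>\<^bsub>N\<^esub> lin_sum K X N f p"
      unfolding lin_sum_def using f coeff_closed[OF p] r J
      by (intro N.finsum_smult_ldistr[symmetric]) auto
    finally show ?thesis .
  qed
qed

lemma lin_sum_basis:
  assumes N: "module K N" and f: "f \<in> X \<rightarrow> carrier N" and x: "x \<in> X"
  shows "lin_sum K X N f (basis_elem K X x) = f x"
proof -
  interpret N: module K N by fact
  have "lin_sum K X N f (basis_elem K X x) = (\<Oplus>\<^bsub>N\<^esub>y\<in>{x}. basis_elem K X x y \<odot>\<^bsub>N\<^esub> f y)"
    using x by (intro lin_sum_superset[OF N f basis_closed[OF x]])
      (auto simp: basis_elem_def split: if_splits)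
  also have "\<dots> = f x" using x f by (simp add: basis_elem_def Pi_iff)
  finally show ?thesis .
qed

lemma lin_sum_basis_elem:
  assumes p: "p \<in> carrier F"
  shows "lin_sum K X F (basis_elem K X) p = p"
proof
  fix y
  let ?J = "{x \<in> X. p x \<noteq> \<zero>\<^bsub>K\<^esub>}"
  have b: "basis_elem K X \<in> X \<rightarrow> carrier F" by (simp add: basis_closed)
  show "lin_sum K X F (basis_elem K X) p y = p y"
  proof (cases "y \<in> X")
    case False
    have u: "q y = undefined" if "q \<in> carrier F" for q
      using that False by (intro PiE_arb[of q X]) (auto simp: carrier_F)
    show ?thesis using u[OF lin_sum_closed[OF module_F b p]] u[OF p] by simp
  next
    case True
    \<comment> \<open>evaluation at \<open>y\<close> is a linear map to a one-dimensional space\<close>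
    let ?L = "func_space {y}"
    interpret L: module K ?L by (rule func_space_is_module)
    have ev: "(\<lambda>q. restrict q {y}) \<in> module_hom K F ?L"
      using True by (intro module_homI) (auto simp: func_space_def F_ops coeff_closed)
    have "restrict (lin_sum K X F (basis_elem K X) p) {y}
        = (\<Oplus>\<^bsub>?L\<^esub>x\<in>?J. restrict (p x \<odot>\<^bsub>F\<^esub> basis_elem K X x) {y})"
      unfolding lin_sum_def
      by (rule module_hom_finsum[OF module_F L.module_axioms ev])
        (auto simp: coeff_closed[OF p] basis_closed)
    also have "\<dots> = (\<Oplus>\<^bsub>?L\<^esub>x\<in>?J. if y = x then restrict p {y} else \<zero>\<^bsub>?L\<^esub>)"
      using True coeff_closed[OF p]
      by (intro L.finsum_cong') (auto simp: func_space_def F_ops basis_elem_def)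
    also have "\<dots> = restrict p {y}"
    proof (cases "y \<in> ?J")
      case True
      then show ?thesis using p coeff_closed[OF p]
        by (intro L.add.finprod_singleton) (auto simp: carrier_F func_space_def)
    next
      case False
      then have "(\<Oplus>\<^bsub>?L\<^esub>x\<in>?J. if y = x then restrict p {y} else \<zero>\<^bsub>?L\<^esub>) = \<zero>\<^bsub>?L\<^esub>"
        by (intro L.add.finprod_one_eqI) auto
      with False True show ?thesis by (auto simp: func_space_def)
    qed
    finally have "restrict (lin_sum K X F (basis_elem K X) p) {y} y = restrict p {y} y" by simp
    then show ?thesis by simp
  qed
qed

end

locale presentation = free_presentation K X
  for K :: "('k, 'r) ring_scheme" and X :: "'x set" +
  fixes R :: "('x \<Rightarrow> 'k) set"
  assumes rels_closed: "R \<subseteq> carrier (free_space K X)"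
begin

abbreviation "W \<equiv> module.span K F R"
abbreviation "P \<equiv> presented K X R"
abbreviation "gen \<equiv> gen_class K X R"

lemma submodule_W: "LinearCombinations.submodule K W F"
  by (rule F.span_is_submodule[OF rels_closed])

sublocale W: abelian_subgroup W F
proof (rule abelian_subgroupI3)
  interpret S: LinearCombinations.submodule K W F by (rule submodule_W)
  have "\<ominus>\<^bsub>F\<^esub> w \<in> W" if "w \<in> W" for w
    using that S.subset S.smult_closed[of "\<ominus>\<^bsub>K\<^esub> \<one>\<^bsub>K\<^esub>" w] F.smult_minus_1[of w]
    by (simp add: subset_iff)
  then show "additive_subgroup W F"
    using S.subset by (intro additive_subgroupI subgroup.intro) (auto simp: a_inv_def)
  show "abelian_group F" by (rule F.abelian_group_axioms)
qed

lemma smult_W: "\<lbrakk>r \<in> carrier K; w \<in> W\<rbrakk> \<Longrightarrow> r \<odot>\<^bsub>F\<^esub> w \<in> W"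
  using LinearCombinations.submodule.smult_closed[OF submodule_W] .

abbreviation cls :: "('x \<Rightarrow> 'k) \<Rightarrow> ('x \<Rightarrow> 'k) set" where "cls p \<equiv> W +>\<^bsub>F\<^esub> p"

lemma P_ops:
  "carrier P = cls ` carrier F"
  "\<zero>\<^bsub>P\<^esub> = W"
  "C \<oplus>\<^bsub>P\<^esub> D = C <+>\<^bsub>F\<^esub> D"
  "r \<odot>\<^bsub>P\<^esub> C = (\<Union>v\<in>C. cls (r \<odot>\<^bsub>F\<^esub> v))"
  by (auto simp: presented_def quotient_space_def A_RCOSETS_def' a_r_coset_def')

lemma cls_eqI: "\<lbrakk>p \<in> carrier F; q \<in> cls p\<rbrakk> \<Longrightarrow> cls q = cls p"
  using W.a_repr_independence' by blast

lemma cls_self: "p \<in> carrier F \<Longrightarrow> p \<in> cls p"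
  by (rule W.a_rcos_self)

lemma cls_add: "\<lbrakk>p \<in> carrier F; q \<in> carrier F\<rbrakk> \<Longrightarrow> cls p \<oplus>\<^bsub>P\<^esub> cls q = cls (p \<oplus>\<^bsub>F\<^esub> q)"
  by (simp add: P_ops W.a_rcos_sum)

lemma cls_smult:
  assumes r: "r \<in> carrier K" and p: "p \<in> carrier F"
  shows "r \<odot>\<^bsub>P\<^esub> cls p = cls (r \<odot>\<^bsub>F\<^esub> p)"
proof -
  have "cls (r \<odot>\<^bsub>F\<^esub> v) = cls (r \<odot>\<^bsub>F\<^esub> p)" if v: "v \<in> cls p" for v
  proof -
    obtain w where w: "w \<in> W" "v = w \<oplus>\<^bsub>F\<^esub> p" using v by (auto simp: a_r_coset_def')
    have "r \<odot>\<^bsub>F\<^esub> v \<in> cls (r \<odot>\<^bsub>F\<^esub> p)"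
      using w r p smult_W[OF r w(1)] by (auto simp: a_r_coset_def' F.smult_r_distr)
    then show ?thesis using cls_eqI r p by auto
  qed
  then have "(\<Union>v\<in>cls p. cls (r \<odot>\<^bsub>F\<^esub> v)) = (\<Union>v\<in>cls p. cls (r \<odot>\<^bsub>F\<^esub> p))"
    by (intro SUP_cong refl)
  also have "\<dots> = cls (r \<odot>\<^bsub>F\<^esub> p)" using cls_self[OF p] by blast
  finally show ?thesis by (simp only: P_ops(4))
qed

lemma cls_zero: "cls \<zero>\<^bsub>F\<^esub> = \<zero>\<^bsub>P\<^esub>"
  using W.a_subset by (simp add: P_ops)

lemma module_P: "module K P"
proof (rule module_criteria, goal_cases)
  case 1 show ?case by (rule cring_axioms)
next
  case 2 show ?case using cls_zero P_ops(1) F.zero_closed by (metis imageI)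
next
  case 3 then show ?case by (auto simp: P_ops(1) cls_add)
next
  case 4 show ?case
  proof
    fix v assume "v \<in> carrier P"
    then obtain p where p: "p \<in> carrier F" "v = cls p" by (auto simp: P_ops(1))
    then show "\<exists>neg_v\<in>carrier P. v \<oplus>\<^bsub>P\<^esub> neg_v = \<zero>\<^bsub>P\<^esub>"
      by (intro bexI[of _ "cls (\<ominus>\<^bsub>F\<^esub> p)"]) (auto simp: P_ops(1) cls_add F.r_neg cls_zero)
  qed
qed (auto simp: P_ops(1) cls_add cls_smult cls_zero[symmetric] F.a_ac
        F.smult_assoc1 F.smult_l_distr F.smult_r_distr)

lemma vectorspace_P: "vectorspace K P"
  using module_P field_axioms by (intro vectorspace.intro)

sublocale P: module K P by (rule module_P)

lemma cls_hom: "cls \<in> module_hom K F P"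
  by (intro module_homI) (auto simp: P_ops(1) cls_add cls_smult)

lemma gen_eq: "gen x = cls (basis_elem K X x)"
  by (simp add: gen_class_def)

lemma gen_closed: "x \<in> X \<Longrightarrow> gen x \<in> carrier P"
  by (auto simp: gen_eq P_ops(1) basis_closed)

text \<open>The chosen representative in \<open>lin_ext\<close> exists because cosets are not empty.\<close>

lemma some_rep:
  assumes "t \<in> carrier P"
  shows "(SOME p. p \<in> t) \<in> carrier F" "(SOME p. p \<in> t) \<in> t" "cls (SOME p. p \<in> t) = t"
proof -
  obtain q where q: "q \<in> carrier F" "t = cls q" using assms by (auto simp: P_ops(1))
  then have "q \<in> t" using cls_self by simp
  then show *: "(SOME p. p \<in> t) \<in> t" by (rule someI[of "\<lambda>p. p \<in> t"])
  show "(SOME p. p \<in> t) \<in> carrier F" using * q W.a_elemrcos_carrier by blast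
  show "cls (SOME p. p \<in> t) = t" using cls_eqI q * by simp
qed

lemma lin_sum_kills_W:
  assumes N: "module K N" and f: "f \<in> X \<rightarrow> carrier N"
    and r: "\<And>p. p \<in> R \<Longrightarrow> lin_sum K X N f p = \<zero>\<^bsub>N\<^esub>" and w: "w \<in> W"
  shows "lin_sum K X N f w = \<zero>\<^bsub>N\<^esub>"
proof -
  interpret mod_hom K F N "lin_sum K X N f"
    using N module_F lin_sum_hom[OF N f] by (intro mod_hom.intro mod_hom_axioms.intro)
  have "R \<subseteq> ker" using r rels_closed by (auto simp: ker_def)
  then have "W \<subseteq> ker" by (rule F.span_is_subset[OF _ ker_is_submodule])
  with w show ?thesis by (auto simp: ker_def)
qed

lemma rel_in_W: "p \<in> R \<Longrightarrow> p \<in> W"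
  using F.in_own_span[OF rels_closed] by blast

lemma lin_ext_closed:
  assumes "module K N" "\<And>x. x \<in> X \<Longrightarrow> f x \<in> carrier N" "t \<in> carrier P"
  shows "lin_ext K X N f t \<in> carrier N"
  unfolding lin_ext_eq using assms some_rep by (intro lin_sum_closed) auto

lemma lin_ext_cong:
  assumes N: "module K N" and f: "\<And>x. x \<in> X \<Longrightarrow> f x \<in> carrier N"
    and fg: "\<And>x. x \<in> X \<Longrightarrow> g x = f x" and t: "t \<in> carrier P"
  shows "lin_ext K X N g t = lin_ext K X N f t"
proof -
  interpret N: module K N by fact
  show ?thesis unfolding lin_ext_eq lin_sum_def
    using f fg coeff_closed[OF some_rep(1)[OF t]] by (intro N.finsum_cong') auto
qed

text \<open>Both sides are the same linear combination, taken with the coefficients of the same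
  representative of \<open>t\<close>; independence of the representative is a separate question, answered by
  \<open>lin_ext_cls\<close>.\<close>

lemma lin_ext_commute:
  assumes M: "module K M" and N: "module K N" and h: "h \<in> module_hom K M N"
    and f: "\<And>x. x \<in> X \<Longrightarrow> f x \<in> carrier M" and t: "t \<in> carrier P"
  shows "h (lin_ext K X M f t) = lin_ext K X N (\<lambda>x. h (f x)) t"
proof -
  interpret M: module K M by fact
  interpret N: module K N by fact
  let ?p = "SOME p. p \<in> t"
  note c = coeff_closed[OF some_rep(1)[OF t]]
  have "h (lin_ext K X M f t) = (\<Oplus>\<^bsub>N\<^esub>x\<in>{x \<in> X. ?p x \<noteq> \<zero>\<^bsub>K\<^esub>}. h (?p x \<odot>\<^bsub>M\<^esub> f x))"
    unfolding lin_ext_eq lin_sum_def by (rule module_hom_finsum[OF M N h]) (auto simp: c f)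
  also have "\<dots> = lin_ext K X N (\<lambda>x. h (f x)) t"
    unfolding lin_ext_eq lin_sum_def using c f module_hom_in[OF h] module_hom_smult[OF h]
    by (intro N.finsum_cong') auto
  finally show ?thesis .
qed

text \<open>The representative of \<open>t\<close> does not depend on \<open>u\<close>, so this is a fixed linear combination of
  linear functions of \<open>u\<close>.\<close>

lemma lin_ext_param:
  assumes N: "module K N" and f: "\<And>x. x \<in> X \<Longrightarrow> (\<lambda>u. f u x) \<in> module_hom K U N"
    and t: "t \<in> carrier P"
  shows "(\<lambda>u. lin_ext K X N (f u) t) \<in> module_hom K U N"
  unfolding lin_ext_eq lin_sum_def
proof (rule finsum_module_hom[OF N])
  let ?p = "SOME p. p \<in> t"
  show "finite {x \<in> X. ?p x \<noteq> \<zero>\<^bsub>K\<^esub>}" using some_rep(1)[OF t] by (simp add: carrier_F)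
  show "(\<lambda>u. ?p x \<odot>\<^bsub>N\<^esub> f u x) \<in> module_hom K U N" if "x \<in> {x \<in> X. ?p x \<noteq> \<zero>\<^bsub>K\<^esub>}" for x
    using that module_hom_comp[OF f smult_module_hom[OF N coeff_closed[OF some_rep(1)[OF t]]]]
    by auto
qed

definition compatible :: "('k, 'n, 's) module_scheme \<Rightarrow> ('x \<Rightarrow> 'n) \<Rightarrow> bool" where
  "compatible N f \<longleftrightarrow> (\<forall>x\<in>X. f x \<in> carrier N) \<and> (\<forall>p\<in>R. lin_sum K X N f p = \<zero>\<^bsub>N\<^esub>)"

text \<open>The chosen representative differs from \<open>p\<close> by an element of the span of the relations, on
  which \<open>f\<close> extends to zero.\<close>

lemma lin_ext_cls:
  assumes N: "module K N" and f: "compatible N f" and p: "p \<in> carrier F"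
  shows "lin_ext K X N f (cls p) = lin_sum K X N f p"
proof -
  have f': "f \<in> X \<rightarrow> carrier N" using f by (auto simp: compatible_def)
  interpret mod_hom K F N "lin_sum K X N f"
    using N module_F lin_sum_hom[OF N f'] by (intro mod_hom.intro mod_hom_axioms.intro)
  have "cls p \<in> carrier P" using p by (simp add: P_ops(1))
  note q = some_rep[OF this]
  obtain w where w: "w \<in> W" "(SOME q. q \<in> cls p) = w \<oplus>\<^bsub>F\<^esub> p"
    using q(2) by (auto simp: a_r_coset_def')
  have "lin_sum K X N f w = \<zero>\<^bsub>N\<^esub>"
    using lin_sum_kills_W[OF N f' _ w(1)] f by (auto simp: compatible_def)
  moreover have "w \<in> carrier F" using w W.a_subset by auto
  ultimately show ?thesis using w(2) p by (simp add: lin_ext_eq)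
qed

lemma lin_ext_hom:
  assumes N: "module K N" and f: "compatible N f"
  shows "lin_ext K X N f \<in> module_hom K P N"
proof -
  have f': "f \<in> X \<rightarrow> carrier N" using f by (auto simp: compatible_def)
  interpret mod_hom K F N "lin_sum K X N f"
    using N module_F lin_sum_hom[OF N f'] by (intro mod_hom.intro mod_hom_axioms.intro)
  show ?thesis
    by (intro module_homI) (auto simp: P_ops(1) cls_add cls_smult lin_ext_cls[OF N f])
qed

lemma lin_ext_gen:
  assumes N: "module K N" and f: "compatible N f" and x: "x \<in> X"
  shows "lin_ext K X N f (gen x) = f x"
  using assms by (auto simp: gen_eq lin_ext_cls basis_closed lin_sum_basis compatible_def)

lemma lin_sum_gen: "p \<in> carrier F \<Longrightarrow> lin_sum K X P gen p = cls p"
proof -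
  assume p: "p \<in> carrier F"
  have "cls p = cls (lin_sum K X F (basis_elem K X) p)" using lin_sum_basis_elem[OF p] by simp
  also have "\<dots> = (\<Oplus>\<^bsub>P\<^esub>x\<in>{x \<in> X. p x \<noteq> \<zero>\<^bsub>K\<^esub>}. cls (p x \<odot>\<^bsub>F\<^esub> basis_elem K X x))"
    unfolding lin_sum_def
    by (rule module_hom_finsum[OF module_F module_P cls_hom])
      (auto simp: coeff_closed[OF p] basis_closed)
  also have "\<dots> = lin_sum K X P gen p"
    unfolding lin_sum_def using coeff_closed[OF p]
    by (intro P.finsum_cong') (auto simp: gen_closed cls_smult basis_closed gen_eq P_ops(1))
  finally show ?thesis by simp
qed

lemma lin_ext_gen_id: "t \<in> carrier P \<Longrightarrow> lin_ext K X P gen t = t"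
  using some_rep by (simp add: lin_ext_eq lin_sum_gen)

text \<open>The classes of the generators span, in the precise form \<open>lin_ext_gen_id\<close>; applying \<open>h\<close> to
  that identity shows that \<open>h\<close> is determined by its values on generators.\<close>

lemma hom_eq_lin_ext:
  assumes N: "module K N" and h: "h \<in> module_hom K P N" and t: "t \<in> carrier P"
  shows "h t = lin_ext K X N (\<lambda>x. h (gen x)) t"
  using lin_ext_commute[OF module_P N h _ t, of gen] gen_closed lin_ext_gen_id[OF t] by simp

lemma hom_ext:
  assumes N: "module K N" and h: "h \<in> module_hom K P N" and g: "g \<in> module_hom K P N"
    and e: "\<And>x. x \<in> X \<Longrightarrow> h (gen x) = g (gen x)" and t: "t \<in> carrier P"
  shows "h t = g t"
  unfolding hom_eq_lin_ext[OF N h t] hom_eq_lin_ext[OF N g t]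
  by (rule lin_ext_cong[OF N _ _ t]) (auto simp: e gen_closed module_hom_in[OF g])

end

context free_presentation
begin

lemma slot_rels_closed:
  assumes M: "module K M" and J: "\<And>j u. \<lbrakk>j \<in> J; u \<in> carrier M\<rbrakk> \<Longrightarrow> j u \<in> X"
  shows "slot_rels K X M J \<subseteq> carrier F"
proof -
  interpret M: module K M by fact
  show ?thesis unfolding slot_rels_def
    by (auto intro!: F.minus_closed F.a_closed F.smult_closed basis_closed J)
qed

lemma lin_sum_diff:
  assumes N: "module K N" and f: "f \<in> X \<rightarrow> carrier N" and p: "p \<in> carrier F" and q: "q \<in> carrier F"
  shows "lin_sum K X N f (p \<ominus>\<^bsub>F\<^esub> q) = lin_sum K X N f p \<ominus>\<^bsub>N\<^esub> lin_sum K X N f q"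
proof -
  interpret mod_hom K F N "lin_sum K X N f"
    using N module_F lin_sum_hom[OF N f] by (intro mod_hom.intro mod_hom_axioms.intro)
  show ?thesis using p q by simp
qed

lemma lin_sum_basis_diff:
  assumes N: "module K N" and f: "f \<in> X \<rightarrow> carrier N" and xy: "x \<in> X" "y \<in> X" and eq: "f x = f y"
  shows "lin_sum K X N f (basis_elem K X x \<ominus>\<^bsub>F\<^esub> basis_elem K X y) = \<zero>\<^bsub>N\<^esub>"
proof -
  interpret N: module K N by fact
  have "f y \<in> carrier N" using f xy by auto
  then have "f y \<ominus>\<^bsub>N\<^esub> f y = \<zero>\<^bsub>N\<^esub>" by (simp add: N.r_neg a_minus_def)
  then show ?thesis using xy eq by (simp add: lin_sum_diff[OF N f] basis_closed lin_sum_basis[OF N f])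
qed

text \<open>A function respects the slot relations as soon as it is linear in every slot. Conversely, the
  classes of the generators are linear in every slot (\<open>gen_slot_hom\<close>).\<close>

lemma lin_sum_slot_rels:
  assumes M: "module K M" and N: "module K N"
    and J: "\<And>j u. \<lbrakk>j \<in> J; u \<in> carrier M\<rbrakk> \<Longrightarrow> j u \<in> X"
    and f: "\<And>x. x \<in> X \<Longrightarrow> f x \<in> carrier N"
    and lin: "\<And>j. j \<in> J \<Longrightarrow> (\<lambda>u. f (j u)) \<in> module_hom K M N"
    and p: "p \<in> slot_rels K X M J"
  shows "lin_sum K X N f p = \<zero>\<^bsub>N\<^esub>"
proof -
  interpret M: module K M by fact
  interpret N: module K N by fact
  have f': "f \<in> X \<rightarrow> carrier N" using f by simp
  note hom = lin_sum_hom[OF N f']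
  note b = lin_sum_basis[OF N f'] basis_closed
  have z: "x \<ominus>\<^bsub>N\<^esub> x = \<zero>\<^bsub>N\<^esub>" if "x \<in> carrier N" for x
    using that by (simp add: N.r_neg a_minus_def)
  from p consider
    (add) j u v where "j \<in> J" "u \<in> carrier M" "v \<in> carrier M"
      "p = basis_elem K X (j (u \<oplus>\<^bsub>M\<^esub> v))
        \<ominus>\<^bsub>F\<^esub> (basis_elem K X (j u) \<oplus>\<^bsub>F\<^esub> basis_elem K X (j v))"
  | (smult) j r u where "j \<in> J" "r \<in> carrier K" "u \<in> carrier M"
      "p = basis_elem K X (j (r \<odot>\<^bsub>M\<^esub> u)) \<ominus>\<^bsub>F\<^esub> (r \<odot>\<^bsub>F\<^esub> basis_elem K X (j u))"
    unfolding slot_rels_def by blast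
  then show ?thesis
  proof cases
    case add
    have X: "j u \<in> X" "j v \<in> X" "j (u \<oplus>\<^bsub>M\<^esub> v) \<in> X" using J add by auto
    have "lin_sum K X N f p = f (j (u \<oplus>\<^bsub>M\<^esub> v)) \<ominus>\<^bsub>N\<^esub> (f (j u) \<oplus>\<^bsub>N\<^esub> f (j v))"
      using X by (simp add: add(4) lin_sum_diff[OF N f'] module_hom_add[OF hom] b)
    then show ?thesis
      using module_hom_add[OF lin[OF add(1)] add(2,3)] X z f by simp
  next
    case smult
    have X: "j u \<in> X" "j (r \<odot>\<^bsub>M\<^esub> u) \<in> X" using J smult by auto
    have "lin_sum K X N f p = f (j (r \<odot>\<^bsub>M\<^esub> u)) \<ominus>\<^bsub>N\<^esub> (r \<odot>\<^bsub>N\<^esub> f (j u))"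
      using X smult(2) by (simp add: smult(4) lin_sum_diff[OF N f'] module_hom_smult[OF hom] b)
    then show ?thesis
      using module_hom_smult[OF lin[OF smult(1)] smult(2,3)] X z f smult(2) by simp
  qed
qed

end

context presentation
begin

lemma cls_eq_of_diff:
  assumes "p \<ominus>\<^bsub>F\<^esub> q \<in> R" "p \<in> carrier F" "q \<in> carrier F"
  shows "cls p = cls q"
proof -
  have "p \<oplus>\<^bsub>F\<^esub> \<ominus>\<^bsub>F\<^esub> q \<in> W" using rel_in_W[OF assms(1)] by (simp add: a_minus_def)
  then have "p \<in> cls q" using assms(2,3) by (intro W.a_rcos_module_rev)
  then show ?thesis using cls_eqI[OF assms(3)] by simp
qed

lemma gen_slot_hom:
  assumes M: "module K M" and J: "\<And>u. u \<in> carrier M \<Longrightarrow> j u \<in> X"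
    and R: "slot_rels K X M J \<subseteq> R" and j: "j \<in> J"
  shows "(\<lambda>u. gen (j u)) \<in> module_hom K M P"
proof (rule module_homI)
  interpret M: module K M by fact
  show "gen (j u) \<in> carrier P" if "u \<in> carrier M" for u
    using that by (intro gen_closed J)
  show "gen (j (u \<oplus>\<^bsub>M\<^esub> v)) = gen (j u) \<oplus>\<^bsub>P\<^esub> gen (j v)"
    if u: "u \<in> carrier M" and v: "v \<in> carrier M" for u v
  proof -
    note b = basis_closed[OF J[OF u]] basis_closed[OF J[OF v]]
    have "basis_elem K X (j (u \<oplus>\<^bsub>M\<^esub> v))
        \<ominus>\<^bsub>F\<^esub> (basis_elem K X (j u) \<oplus>\<^bsub>F\<^esub> basis_elem K X (j v)) \<in> R"
      using j u v by (intro subsetD[OF R]) (unfold slot_rels_def, blast)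
    then have "cls (basis_elem K X (j (u \<oplus>\<^bsub>M\<^esub> v)))
        = cls (basis_elem K X (j u) \<oplus>\<^bsub>F\<^esub> basis_elem K X (j v))"
      using u v b by (intro cls_eq_of_diff basis_closed J) auto
    then show ?thesis using b by (simp add: gen_eq cls_add)
  qed
  show "gen (j (r \<odot>\<^bsub>M\<^esub> u)) = r \<odot>\<^bsub>P\<^esub> gen (j u)"
    if r: "r \<in> carrier K" and u: "u \<in> carrier M" for r u
  proof -
    note b = basis_closed[OF J[OF u]]
    have "basis_elem K X (j (r \<odot>\<^bsub>M\<^esub> u)) \<ominus>\<^bsub>F\<^esub> (r \<odot>\<^bsub>F\<^esub> basis_elem K X (j u)) \<in> R"
      using j r u by (intro subsetD[OF R]) (unfold slot_rels_def, blast)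
    then have "cls (basis_elem K X (j (r \<odot>\<^bsub>M\<^esub> u))) = cls (r \<odot>\<^bsub>F\<^esub> basis_elem K X (j u))"
      using r u b by (intro cls_eq_of_diff basis_closed J) auto
    then show ?thesis using b r by (simp add: gen_eq cls_smult)
  qed
qed

end

section \<open>Tensor products of two spaces\<close>

definition bilinear_map ::
    "('k, 'r) ring_scheme \<Rightarrow> ('k, 'a, 's) module_scheme \<Rightarrow> ('k, 'b, 't) module_scheme
      \<Rightarrow> ('k, 'n, 'u) module_scheme \<Rightarrow> ('a \<Rightarrow> 'b \<Rightarrow> 'n) \<Rightarrow> bool" where
  "bilinear_map K A B N f \<longleftrightarrow>
     (\<forall>b\<in>carrier B. (\<lambda>a. f a b) \<in> module_hom K A N) \<and> (\<forall>a\<in>carrier A. f a \<in> module_hom K B N)"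

lemma bilinear_mapI:
  assumes "\<And>b. b \<in> carrier B \<Longrightarrow> (\<lambda>a. f a b) \<in> module_hom K A N"
    and "\<And>a. a \<in> carrier A \<Longrightarrow> (\<lambda>b. f a b) \<in> module_hom K B N"
  shows "bilinear_map K A B N f"
  using assms by (auto simp: bilinear_map_def)

lemma bilinear_mapD:
  assumes "bilinear_map K A B N f"
  shows "b \<in> carrier B \<Longrightarrow> (\<lambda>a. f a b) \<in> module_hom K A N"
    and "a \<in> carrier A \<Longrightarrow> (\<lambda>b. f a b) \<in> module_hom K B N"
    and "\<lbrakk>a \<in> carrier A; b \<in> carrier B\<rbrakk> \<Longrightarrow> f a b \<in> carrier N"
  using assms by (auto simp: bilinear_map_def module_hom_in)

lemma bilinear_map_comp:
  assumes "bilinear_map K A B M f" "h \<in> module_hom K M N"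
  shows "bilinear_map K A B N (\<lambda>a b. h (f a b))"
  by (intro bilinear_mapI)
    (erule module_hom_comp[OF bilinear_mapD(1)[OF assms(1)] assms(2)]
      module_hom_comp[OF bilinear_mapD(2)[OF assms(1)] assms(2)])+

locale tensor_product = field K + A: module K A + B: module K B
  for K :: "('k, 'r) ring_scheme"
    and A :: "('k, 'a, 's) module_scheme" and B :: "('k, 'b, 't) module_scheme"
begin

sublocale T: presentation K "carrier A \<times> carrier B" "tensor_rels K A B"
proof unfold_locales
  interpret free_presentation K "carrier A \<times> carrier B" by unfold_locales
  show "tensor_rels K A B \<subseteq> carrier (free_space K (carrier A \<times> carrier B))"
    unfolding tensor_rels_def
    by (intro Un_least slot_rels_closed A.module_axioms B.module_axioms) auto
qed

lemma tensor_eq: "tensor K A B = presented K (carrier A \<times> carrier B) (tensor_rels K A B)"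
  by (simp add: tensor_def)

lemma module_tensor: "module K (tensor K A B)"
  and vectorspace_tensor: "vectorspace K (tensor K A B)"
  using T.module_P T.vectorspace_P by (simp_all add: tensor_eq)

lemma tens_bilinear: "bilinear_map K A B (tensor K A B) (tens K A B)"
  unfolding tens_def tensor_eq
proof (rule bilinear_mapI)
  fix b assume b: "b \<in> carrier B"
  show "(\<lambda>a. T.gen (a, b)) \<in> module_hom K A T.P"
    by (rule T.gen_slot_hom[OF A.module_axioms, where J = "{\<lambda>a. (a, b) | b. b \<in> carrier B}"])
      (use b in \<open>auto simp: tensor_rels_def\<close>)
next
  fix a assume a: "a \<in> carrier A"
  show "(\<lambda>b. T.gen (a, b)) \<in> module_hom K B T.P"
    by (rule T.gen_slot_hom[OF B.module_axioms, where J = "{\<lambda>b. (a, b) | a. a \<in> carrier A}"])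
      (use a in \<open>auto simp: tensor_rels_def\<close>)
qed

lemmas tens_closed = bilinear_mapD(3)[OF tens_bilinear]

lemma compatible_bilinear:
  assumes N: "module K N" and f: "bilinear_map K A B N f"
  shows "T.compatible N (\<lambda>(a, b). f a b)"
  unfolding T.compatible_def
proof (intro conjI ballI)
  show c: "(case x of (a, b) \<Rightarrow> f a b) \<in> carrier N" if "x \<in> carrier A \<times> carrier B" for x
    using that bilinear_mapD(3)[OF f] by auto
  fix p assume "p \<in> tensor_rels K A B"
  then consider "p \<in> slot_rels K (carrier A \<times> carrier B) A {\<lambda>a. (a, b) | b. b \<in> carrier B}"
    | "p \<in> slot_rels K (carrier A \<times> carrier B) B {\<lambda>b. (a, b) | a. a \<in> carrier A}"
    by (auto simp: tensor_rels_def)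
  then show "lin_sum K (carrier A \<times> carrier B) N (\<lambda>(a, b). f a b) p = \<zero>\<^bsub>N\<^esub>"
  proof cases
    case 1
    then show ?thesis
      by (rule T.lin_sum_slot_rels[OF A.module_axioms N, rotated -1])
        (use c bilinear_mapD(1)[OF f] in auto)
  next
    case 2
    then show ?thesis
      by (rule T.lin_sum_slot_rels[OF B.module_axioms N, rotated -1])
        (use c bilinear_mapD(2)[OF f] in auto)
  qed
qed

lemma tensor_ext_hom:
  assumes "module K N" "bilinear_map K A B N f"
  shows "tensor_ext K A B N f \<in> module_hom K (tensor K A B) N"
  unfolding tensor_ext_def tensor_eq by (rule T.lin_ext_hom[OF assms(1) compatible_bilinear[OF assms]])

lemma tensor_ext_tens:
  assumes "module K N" "bilinear_map K A B N f" "a \<in> carrier A" "b \<in> carrier B"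
  shows "tensor_ext K A B N f (tens K A B a b) = f a b"
  unfolding tensor_ext_def tens_def
  using T.lin_ext_gen[OF assms(1) compatible_bilinear[OF assms(1,2)]] assms(3,4) by simp

lemma tensor_ext_closed:
  assumes "module K N" "\<And>a b. \<lbrakk>a \<in> carrier A; b \<in> carrier B\<rbrakk> \<Longrightarrow> f a b \<in> carrier N"
    and "t \<in> carrier (tensor K A B)"
  shows "tensor_ext K A B N f t \<in> carrier N"
  unfolding tensor_ext_def using assms by (intro T.lin_ext_closed) (auto simp: tensor_eq)

lemma tensor_ext_cong:
  assumes "module K N" "\<And>a b. \<lbrakk>a \<in> carrier A; b \<in> carrier B\<rbrakk> \<Longrightarrow> f a b \<in> carrier N"
    and "\<And>a b. \<lbrakk>a \<in> carrier A; b \<in> carrier B\<rbrakk> \<Longrightarrow> g a b = f a b"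
    and "t \<in> carrier (tensor K A B)"
  shows "tensor_ext K A B N g t = tensor_ext K A B N f t"
  unfolding tensor_ext_def using assms by (intro T.lin_ext_cong) (auto simp: tensor_eq)

lemma tensor_ext_commute:
  assumes M: "module K M" and N: "module K N" and h: "h \<in> module_hom K M N"
    and f: "\<And>a b. \<lbrakk>a \<in> carrier A; b \<in> carrier B\<rbrakk> \<Longrightarrow> f a b \<in> carrier M"
    and t: "t \<in> carrier (tensor K A B)"
  shows "h (tensor_ext K A B M f t) = tensor_ext K A B N (\<lambda>a b. h (f a b)) t"
proof -
  have "h (tensor_ext K A B M f t)
      = lin_ext K (carrier A \<times> carrier B) N (\<lambda>x. h (case x of (a, b) \<Rightarrow> f a b)) t"
    unfolding tensor_ext_def using f t by (intro T.lin_ext_commute[OF M N h]) (auto simp: tensor_eq)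
  also have "(\<lambda>x. h (case x of (a, b) \<Rightarrow> f a b)) = (\<lambda>(a, b). h (f a b))" by auto
  finally show ?thesis by (simp add: tensor_ext_def)
qed

lemma tensor_ext_param:
  assumes "module K N"
    and "\<And>a b. \<lbrakk>a \<in> carrier A; b \<in> carrier B\<rbrakk> \<Longrightarrow> (\<lambda>u. f u a b) \<in> module_hom K U N"
    and "t \<in> carrier (tensor K A B)"
  shows "(\<lambda>u. tensor_ext K A B N (f u) t) \<in> module_hom K U N"
  unfolding tensor_ext_def using assms by (intro T.lin_ext_param) (auto simp: tensor_eq)

lemma hom_eq_tensor_ext:
  assumes "module K N" "h \<in> module_hom K (tensor K A B) N" "t \<in> carrier (tensor K A B)"
  shows "tensor_ext K A B N (\<lambda>a b. h (tens K A B a b)) t = h t"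
proof -
  have "(\<lambda>x. h (T.gen x)) = (\<lambda>(a, b). h (tens K A B a b))" by (auto simp: tens_def)
  then show ?thesis
    using T.hom_eq_lin_ext[of N h t] assms by (simp add: tensor_ext_def tensor_eq)
qed

lemma tensor_hom_ext:
  assumes "module K N" "h \<in> module_hom K (tensor K A B) N" "g \<in> module_hom K (tensor K A B) N"
    and "\<And>a b. \<lbrakk>a \<in> carrier A; b \<in> carrier B\<rbrakk> \<Longrightarrow> h (tens K A B a b) = g (tens K A B a b)"
    and "t \<in> carrier (tensor K A B)"
  shows "h t = g t"
  using assms by (intro T.hom_ext[of N h g t]) (auto simp: tensor_eq tens_def)

end

section \<open>The factorisation algebra\<close>

locale factorised = factorisation_data K A B \<psi> + K: field K + A: unital_algebra K A + B: unital_algebra K B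
  for K :: "('k, 'r) ring_scheme"
    and A :: "('k, 'a, 's) module_scheme"
    and B :: "('k, 'b, 't) module_scheme"
    and \<psi> +
  assumes factorisation: factorisation
begin

sublocale AB: tensor_product K A B by unfold_locales
sublocale BA: tensor_product K B A by unfold_locales

abbreviation "T \<equiv> tensor K A B"
abbreviation "pure \<equiv> tens K A B"
abbreviation "S \<equiv> fact_alg"
abbreviation inA :: "'a \<Rightarrow> ('a \<times> 'b \<Rightarrow> 'k) set" where "inA a \<equiv> pure a \<one>\<^bsub>B\<^esub>"
abbreviation inB :: "'b \<Rightarrow> ('a \<times> 'b \<Rightarrow> 'k) set" where "inB b \<equiv> pure \<one>\<^bsub>A\<^esub> b"

lemmas module_A = A.module_axioms and module_B = B.module_axioms

lemma mult_hom_A: "x \<in> carrier A \<Longrightarrow> (\<lambda>y. x \<otimes>\<^bsub>A\<^esub> y) \<in> module_hom K A A"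
    "x \<in> carrier A \<Longrightarrow> (\<lambda>y. y \<otimes>\<^bsub>A\<^esub> x) \<in> module_hom K A A"
  by (auto intro!: module_homI simp: A.r_distr A.l_distr A.smult_mult_left A.smult_mult_right)

lemma mult_hom_B: "x \<in> carrier B \<Longrightarrow> (\<lambda>y. x \<otimes>\<^bsub>B\<^esub> y) \<in> module_hom K B B"
    "x \<in> carrier B \<Longrightarrow> (\<lambda>y. y \<otimes>\<^bsub>B\<^esub> x) \<in> module_hom K B B"
  by (auto intro!: module_homI simp: B.r_distr B.l_distr B.smult_mult_left B.smult_mult_right)

lemma psi_hom: "\<psi> \<in> module_hom K (tensor K B A) T"
  and psi_one_left: "a \<in> carrier A \<Longrightarrow> \<psi> (tens K B A \<one>\<^bsub>B\<^esub> a) = inA a"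
  and psi_one_right: "b \<in> carrier B \<Longrightarrow> \<psi> (tens K B A b \<one>\<^bsub>A\<^esub>) = inB b"
  using factorisation by (auto simp: factorisation_def)

lemma hexagon:
  "\<lbrakk>a \<in> carrier A; d \<in> carrier A; b \<in> carrier B; c \<in> carrier B\<rbrakk> \<Longrightarrow>
     sweedler T (\<lambda>x y. sweedler T (\<lambda>z w. pure z (w \<otimes>\<^bsub>B\<^esub> y)) b (a \<otimes>\<^bsub>A\<^esub> x)) c d =
     sweedler T (\<lambda>x y. sweedler T (\<lambda>z w. pure (x \<otimes>\<^bsub>A\<^esub> z) w) (y \<otimes>\<^bsub>B\<^esub> c) d) b a"
  using factorisation by (auto simp: factorisation_def)

lemma psi_closed: "\<lbrakk>b \<in> carrier B; a \<in> carrier A\<rbrakk> \<Longrightarrow> \<psi> (tens K B A b a) \<in> carrier T"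
  by (intro module_hom_in[OF psi_hom] BA.tens_closed)

subsection \<open>Sweedler sums\<close>

lemma sweedler_closed:
  assumes "module K N" "\<And>a b. \<lbrakk>a \<in> carrier A; b \<in> carrier B\<rbrakk> \<Longrightarrow> f a b \<in> carrier N"
    and "b \<in> carrier B" "a \<in> carrier A"
  shows "sweedler N f b a \<in> carrier N"
  unfolding sweedler_def using assms by (intro AB.tensor_ext_closed psi_closed) auto

lemma sweedler_cong:
  assumes "module K N" "\<And>a b. \<lbrakk>a \<in> carrier A; b \<in> carrier B\<rbrakk> \<Longrightarrow> f a b \<in> carrier N"
    and "\<And>a b. \<lbrakk>a \<in> carrier A; b \<in> carrier B\<rbrakk> \<Longrightarrow> g a b = f a b"
    and "b \<in> carrier B" "a \<in> carrier A"
  shows "sweedler N g b a = sweedler N f b a"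
  unfolding sweedler_def using assms by (intro AB.tensor_ext_cong psi_closed) auto

lemma sweedler_commute:
  assumes "module K M" "module K N" "h \<in> module_hom K M N"
    and "\<And>a b. \<lbrakk>a \<in> carrier A; b \<in> carrier B\<rbrakk> \<Longrightarrow> f a b \<in> carrier M"
    and "b \<in> carrier B" "a \<in> carrier A"
  shows "h (sweedler M f b a) = sweedler N (\<lambda>a b. h (f a b)) b a"
  unfolding sweedler_def using assms by (intro AB.tensor_ext_commute psi_closed) auto

lemma sweedler_param:
  assumes "module K N"
    and "\<And>a b. \<lbrakk>a \<in> carrier A; b \<in> carrier B\<rbrakk> \<Longrightarrow> (\<lambda>u. f u a b) \<in> module_hom K U N"
    and "b \<in> carrier B" "a \<in> carrier A"
  shows "(\<lambda>u. sweedler N (f u) b a) \<in> module_hom K U N"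
  unfolding sweedler_def using assms by (intro AB.tensor_ext_param psi_closed) auto

text \<open>The sum is the composition of the universal bilinear map, \<open>\<psi>\<close>, and the linear extension of
  \<open>f\<close>.\<close>

lemma sweedler_bilinear:
  assumes N: "module K N" and f: "bilinear_map K A B N f"
  shows "bilinear_map K B A N (sweedler N f)"
proof -
  have "bilinear_map K B A N (\<lambda>b a. tensor_ext K A B N f (\<psi> (tens K B A b a)))"
    by (rule bilinear_map_comp[OF bilinear_map_comp[OF BA.tens_bilinear psi_hom]
          AB.tensor_ext_hom[OF N f]])
  then show ?thesis unfolding sweedler_def[abs_def] .
qed

lemma sweedler_one:
  assumes N: "module K N" and f: "bilinear_map K A B N f"
  shows "a \<in> carrier A \<Longrightarrow> sweedler N f \<one>\<^bsub>B\<^esub> a = f a \<one>\<^bsub>B\<^esub>"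
    and "b \<in> carrier B \<Longrightarrow> sweedler N f b \<one>\<^bsub>A\<^esub> = f \<one>\<^bsub>A\<^esub> b"
  by (simp_all add: sweedler_def psi_one_left psi_one_right AB.tensor_ext_tens[OF N f])

lemma sweedler_hom:
  assumes "module K N" "h \<in> module_hom K T N" "b \<in> carrier B" "a \<in> carrier A"
  shows "sweedler N (\<lambda>x y. h (pure x y)) b a = h (\<psi> (tens K B A b a))"
  unfolding sweedler_def using assms by (intro AB.hom_eq_tensor_ext psi_closed)

subsection \<open>Multiplication\<close>

lemma S_simps:
  "carrier S = carrier T" "x \<oplus>\<^bsub>S\<^esub> y = x \<oplus>\<^bsub>T\<^esub> y" "\<zero>\<^bsub>S\<^esub> = \<zero>\<^bsub>T\<^esub>" "r \<odot>\<^bsub>S\<^esub> x = r \<odot>\<^bsub>T\<^esub> x"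
  "\<one>\<^bsub>S\<^esub> = pure \<one>\<^bsub>A\<^esub> \<one>\<^bsub>B\<^esub>"
  by (simp_all add: fact_alg_def)

lemma module_hom_S: "module_hom K S N = module_hom K T N" "module_hom K N S = module_hom K N T"
  by (simp_all add: module_hom_def S_simps)

lemma module_T: "module K T" and vectorspace_T: "vectorspace K T"
  by (rule AB.module_tensor AB.vectorspace_tensor)+

lemma module_S: "module K S" and vectorspace_S: "vectorspace K S"
proof -
  interpret T: module K T by (rule module_T)
  show "module K S"
    by (rule module_criteria)
      (auto simp: S_simps T.a_ac T.smult_assoc1 T.smult_l_distr T.smult_r_distr
        intro: K.cring_axioms bexI[of _ "\<ominus>\<^bsub>T\<^esub> v" for v] T.r_neg)
  then show "vectorspace K S" by (intro vectorspace.intro K.field_axioms)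
qed

lemma pure_closed: "\<lbrakk>a \<in> carrier A; b \<in> carrier B\<rbrakk> \<Longrightarrow> pure a b \<in> carrier S"
  by (simp add: S_simps AB.tens_closed)

lemma pure_bilinear: "bilinear_map K A B T pure" by (rule AB.tens_bilinear)

lemma pure_comp_hom_left:
  assumes "f \<in> module_hom K U A" "b \<in> carrier B"
  shows "(\<lambda>u. pure (f u) b) \<in> module_hom K U T"
  using module_hom_comp[OF assms(1) bilinear_mapD(1)[OF pure_bilinear assms(2)]] .

lemma pure_comp_hom_right:
  assumes "f \<in> module_hom K U B" "a \<in> carrier A"
  shows "(\<lambda>u. pure a (f u)) \<in> module_hom K U T"
  using module_hom_comp[OF assms(1) bilinear_mapD(2)[OF pure_bilinear assms(2)]] .

lemma sandwich_bilinear: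
  assumes "a \<in> carrier A" "d \<in> carrier B"
  shows "bilinear_map K A B T (\<lambda>x y. pure (a \<otimes>\<^bsub>A\<^esub> x) (y \<otimes>\<^bsub>B\<^esub> d))"
  using assms by (intro bilinear_mapI pure_comp_hom_left pure_comp_hom_right mult_hom_A mult_hom_B) auto

text \<open>This is \<open>(a \<otimes> b)(c \<otimes> d)\<close>. Its linearity in each argument has to be known before
  the product of \<open>S\<close>, a double linear extension, can be evaluated on pure tensors.\<close>

definition pure_mult :: "'a \<Rightarrow> 'b \<Rightarrow> 'a \<Rightarrow> 'b \<Rightarrow> ('a \<times> 'b \<Rightarrow> 'k) set" where
  "pure_mult a b c d = sweedler T (\<lambda>x y. pure (a \<otimes>\<^bsub>A\<^esub> x) (y \<otimes>\<^bsub>B\<^esub> d)) b c"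

lemma mult_eq:
  "s \<otimes>\<^bsub>S\<^esub> t = tensor_ext K A B T (\<lambda>a b. tensor_ext K A B T (\<lambda>c d. pure_mult a b c d) t) s"
  by (simp add: fact_alg_def pure_mult_def)

lemma pure_mult_hom:
  shows "\<lbrakk>b \<in> carrier B; c \<in> carrier A; d \<in> carrier B\<rbrakk> \<Longrightarrow> (\<lambda>a. pure_mult a b c d) \<in> module_hom K A T"
    and "\<lbrakk>a \<in> carrier A; c \<in> carrier A; d \<in> carrier B\<rbrakk> \<Longrightarrow> (\<lambda>b. pure_mult a b c d) \<in> module_hom K B T"
    and "\<lbrakk>a \<in> carrier A; b \<in> carrier B; d \<in> carrier B\<rbrakk> \<Longrightarrow> (\<lambda>c. pure_mult a b c d) \<in> module_hom K A T"
    and "\<lbrakk>a \<in> carrier A; b \<in> carrier B; c \<in> carrier A\<rbrakk> \<Longrightarrow> (\<lambda>d. pure_mult a b c d) \<in> module_hom K B T"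
  unfolding pure_mult_def
  subgoal by (rule sweedler_param[OF module_T]) (auto intro!: pure_comp_hom_left mult_hom_A)
  subgoal by (rule bilinear_mapD(1)[OF sweedler_bilinear[OF module_T sandwich_bilinear]])
  subgoal by (rule bilinear_mapD(2)[OF sweedler_bilinear[OF module_T sandwich_bilinear]])
  subgoal by (rule sweedler_param[OF module_T]) (auto intro!: pure_comp_hom_right mult_hom_B)
  done

lemma pure_mult_bilinear:
  shows "\<lbrakk>a \<in> carrier A; b \<in> carrier B\<rbrakk> \<Longrightarrow> bilinear_map K A B T (\<lambda>c d. pure_mult a b c d)"
  by (intro bilinear_mapI pure_mult_hom)

lemma mult_fixed_right_bilinear:
  assumes "t \<in> carrier T"
  shows "bilinear_map K A B T (\<lambda>a b. tensor_ext K A B T (\<lambda>c d. pure_mult a b c d) t)"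
  using assms by (intro bilinear_mapI AB.tensor_ext_param module_T pure_mult_hom)

lemma mult_hom_S:
  assumes "t \<in> carrier S"
  shows "(\<lambda>s. s \<otimes>\<^bsub>S\<^esub> t) \<in> module_hom K S S" and "(\<lambda>s. t \<otimes>\<^bsub>S\<^esub> s) \<in> module_hom K S S"
proof -
  have t: "t \<in> carrier T" using assms by (simp add: S_simps)
  show "(\<lambda>s. s \<otimes>\<^bsub>S\<^esub> t) \<in> module_hom K S S"
    unfolding mult_eq module_hom_S by (intro AB.tensor_ext_hom module_T mult_fixed_right_bilinear t)
  show "(\<lambda>s. t \<otimes>\<^bsub>S\<^esub> s) \<in> module_hom K S S"
    unfolding mult_eq module_hom_S
    by (intro AB.tensor_ext_param[OF module_T AB.tensor_ext_hom[OF module_T]] pure_mult_bilinear t)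
qed

lemma mult_closed_S: "\<lbrakk>s \<in> carrier S; t \<in> carrier S\<rbrakk> \<Longrightarrow> s \<otimes>\<^bsub>S\<^esub> t \<in> carrier S"
  using module_hom_in[OF mult_hom_S(1)] .

lemma mult_pure:
  assumes "a \<in> carrier A" "b \<in> carrier B" "c \<in> carrier A" "d \<in> carrier B"
  shows "pure a b \<otimes>\<^bsub>S\<^esub> pure c d = sweedler T (\<lambda>x y. pure (a \<otimes>\<^bsub>A\<^esub> x) (y \<otimes>\<^bsub>B\<^esub> d)) b c"
  unfolding mult_eq using assms
  by (simp add: AB.tensor_ext_tens[OF module_T] AB.tens_closed pure_mult_bilinear mult_fixed_right_bilinear
      flip: pure_mult_def)

text \<open>Both products are images of the two sides of the factorisation axiom for \<open>c\<close>, \<open>e\<close>, \<open>b\<close>, \<open>d\<close>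
  under the linear map that multiplies by \<open>a\<close> from the left and by \<open>f\<close> from the right: the first
  product is \<open>a c\<^sub>\<beta> e\<^sub>\<alpha> \<otimes> (b\<^sup>\<beta> d)\<^sup>\<alpha> f\<close> and the second is \<open>a (c e\<^sub>\<alpha>)\<^sub>\<beta> \<otimes> b\<^sup>\<beta> d\<^sup>\<alpha> f\<close>.\<close>

lemma mult_pure_assoc:
  assumes "a \<in> carrier A" "b \<in> carrier B" "c \<in> carrier A" "d \<in> carrier B" "e \<in> carrier A" "f \<in> carrier B"
  shows "(pure a b \<otimes>\<^bsub>S\<^esub> pure c d) \<otimes>\<^bsub>S\<^esub> pure e f = pure a b \<otimes>\<^bsub>S\<^esub> (pure c d \<otimes>\<^bsub>S\<^esub> pure e f)"
proof -
  let ?M = "tensor_ext K A B T (\<lambda>x y. pure (a \<otimes>\<^bsub>A\<^esub> x) (y \<otimes>\<^bsub>B\<^esub> f))"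
  have M: "?M \<in> module_hom K T T"
    and M_pure: "\<And>x y. \<lbrakk>x \<in> carrier A; y \<in> carrier B\<rbrakk> \<Longrightarrow> ?M (pure x y) = pure (a \<otimes>\<^bsub>A\<^esub> x) (y \<otimes>\<^bsub>B\<^esub> f)"
    using assms sandwich_bilinear[of a f]
    by (simp_all add: AB.tensor_ext_hom AB.tensor_ext_tens module_T)
  note cl = sweedler_closed[OF module_T] AB.tens_closed A.m_closed B.m_closed
  have inner_l: "sweedler T (\<lambda>z w. pure ((a \<otimes>\<^bsub>A\<^esub> x) \<otimes>\<^bsub>A\<^esub> z) (w \<otimes>\<^bsub>B\<^esub> f)) (y \<otimes>\<^bsub>B\<^esub> d) e
      = ?M (sweedler T (\<lambda>z w. pure (x \<otimes>\<^bsub>A\<^esub> z) w) (y \<otimes>\<^bsub>B\<^esub> d) e)"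
    if "x \<in> carrier A" "y \<in> carrier B" for x y
  proof -
    have "?M (sweedler T (\<lambda>z w. pure (x \<otimes>\<^bsub>A\<^esub> z) w) (y \<otimes>\<^bsub>B\<^esub> d) e) = sweedler T (\<lambda>z w. ?M (pure (x \<otimes>\<^bsub>A\<^esub> z) w)) (y \<otimes>\<^bsub>B\<^esub> d) e"
      using assms that by (intro sweedler_commute[OF module_T module_T M]) (simp_all add: cl)
    then show ?thesis
      using assms that
      by (simp only:) (intro sweedler_cong[OF module_T]; simp add: cl M_pure A.m_assoc)
  qed
  have inner_r: "sweedler T (\<lambda>z w. pure (a \<otimes>\<^bsub>A\<^esub> z) (w \<otimes>\<^bsub>B\<^esub> (y \<otimes>\<^bsub>B\<^esub> f))) b (c \<otimes>\<^bsub>A\<^esub> x)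
      = ?M (sweedler T (\<lambda>z w. pure z (w \<otimes>\<^bsub>B\<^esub> y)) b (c \<otimes>\<^bsub>A\<^esub> x))"
    if "x \<in> carrier A" "y \<in> carrier B" for x y
  proof -
    have "?M (sweedler T (\<lambda>z w. pure z (w \<otimes>\<^bsub>B\<^esub> y)) b (c \<otimes>\<^bsub>A\<^esub> x)) = sweedler T (\<lambda>z w. ?M (pure z (w \<otimes>\<^bsub>B\<^esub> y))) b (c \<otimes>\<^bsub>A\<^esub> x)"
      using assms that by (intro sweedler_commute[OF module_T module_T M]) (simp_all add: cl)
    then show ?thesis
      using assms that
      by (simp only:) (intro sweedler_cong[OF module_T]; simp add: cl M_pure B.m_assoc)
  qed
  have "(pure a b \<otimes>\<^bsub>S\<^esub> pure c d) \<otimes>\<^bsub>S\<^esub> pure e f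
      = sweedler T (\<lambda>x y. pure (a \<otimes>\<^bsub>A\<^esub> x) (y \<otimes>\<^bsub>B\<^esub> d) \<otimes>\<^bsub>S\<^esub> pure e f) b c"
    using assms mult_hom_S(1)[of "pure e f"]
    by (simp add: mult_pure module_hom_S pure_closed cl
        sweedler_commute[OF module_T module_T, where h = "\<lambda>s. s \<otimes>\<^bsub>S\<^esub> pure e f"])
  also have "\<dots> = sweedler T (\<lambda>x y. ?M (sweedler T (\<lambda>z w. pure (x \<otimes>\<^bsub>A\<^esub> z) w) (y \<otimes>\<^bsub>B\<^esub> d) e)) b c"
    using assms by (intro sweedler_cong[OF module_T]) (simp_all add: mult_pure inner_l cl module_hom_in[OF M])
  also have "\<dots> = ?M (sweedler T (\<lambda>x y. sweedler T (\<lambda>z w. pure (x \<otimes>\<^bsub>A\<^esub> z) w) (y \<otimes>\<^bsub>B\<^esub> d) e) b c)"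
    using assms by (intro sweedler_commute[OF module_T module_T M, symmetric]) (simp_all add: cl)
  also have "\<dots> = ?M (sweedler T (\<lambda>x y. sweedler T (\<lambda>z w. pure z (w \<otimes>\<^bsub>B\<^esub> y)) b (c \<otimes>\<^bsub>A\<^esub> x)) d e)"
    using assms by (simp add: hexagon)
  also have "\<dots> = sweedler T (\<lambda>x y. ?M (sweedler T (\<lambda>z w. pure z (w \<otimes>\<^bsub>B\<^esub> y)) b (c \<otimes>\<^bsub>A\<^esub> x))) d e"
    using assms by (intro sweedler_commute[OF module_T module_T M]) (simp_all add: cl)
  also have "\<dots> = sweedler T (\<lambda>x y. pure a b \<otimes>\<^bsub>S\<^esub> pure (c \<otimes>\<^bsub>A\<^esub> x) (y \<otimes>\<^bsub>B\<^esub> f)) d e"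
    using assms by (intro sweedler_cong[OF module_T]) (simp_all add: mult_pure inner_r cl module_hom_in[OF M])
  also have "\<dots> = pure a b \<otimes>\<^bsub>S\<^esub> (pure c d \<otimes>\<^bsub>S\<^esub> pure e f)"
    using assms mult_hom_S(2)[of "pure a b"]
    by (simp add: mult_pure module_hom_S pure_closed cl
        sweedler_commute[OF module_T module_T, where h = "\<lambda>s. pure a b \<otimes>\<^bsub>S\<^esub> s"])
  finally show ?thesis .
qed

lemma S_hom_ext:
  assumes "module K N" "h \<in> module_hom K S N" "g \<in> module_hom K S N"
    and "\<And>a b. \<lbrakk>a \<in> carrier A; b \<in> carrier B\<rbrakk> \<Longrightarrow> h (pure a b) = g (pure a b)"
    and "t \<in> carrier S"
  shows "h t = g t"
  using assms by (intro AB.tensor_hom_ext[of N h g t]) (auto simp: module_hom_S S_simps)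

lemma mult_assoc_S:
  assumes "s \<in> carrier S" "t \<in> carrier S" "u \<in> carrier S"
  shows "(s \<otimes>\<^bsub>S\<^esub> t) \<otimes>\<^bsub>S\<^esub> u = s \<otimes>\<^bsub>S\<^esub> (t \<otimes>\<^bsub>S\<^esub> u)"
proof (rule S_hom_ext[OF module_S _ _ _ assms(1), where h = "\<lambda>s. (s \<otimes>\<^bsub>S\<^esub> t) \<otimes>\<^bsub>S\<^esub> u"])
  show "(\<lambda>s. (s \<otimes>\<^bsub>S\<^esub> t) \<otimes>\<^bsub>S\<^esub> u) \<in> module_hom K S S"
    by (rule module_hom_comp[OF mult_hom_S(1) mult_hom_S(1)]) (use assms in auto)
  show "(\<lambda>s. s \<otimes>\<^bsub>S\<^esub> (t \<otimes>\<^bsub>S\<^esub> u)) \<in> module_hom K S S"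
    using assms by (intro mult_hom_S mult_closed_S)
  fix a b assume ab: "a \<in> carrier A" "b \<in> carrier B"
  note pab = pure_closed[OF ab]
  show "(pure a b \<otimes>\<^bsub>S\<^esub> t) \<otimes>\<^bsub>S\<^esub> u = pure a b \<otimes>\<^bsub>S\<^esub> (t \<otimes>\<^bsub>S\<^esub> u)"
  proof (rule S_hom_ext[OF module_S _ _ _ assms(2), where h = "\<lambda>t. (pure a b \<otimes>\<^bsub>S\<^esub> t) \<otimes>\<^bsub>S\<^esub> u"])
    show "(\<lambda>t. (pure a b \<otimes>\<^bsub>S\<^esub> t) \<otimes>\<^bsub>S\<^esub> u) \<in> module_hom K S S"
      by (rule module_hom_comp[OF mult_hom_S(2)[OF pab] mult_hom_S(1)[OF assms(3)]])
    show "(\<lambda>t. pure a b \<otimes>\<^bsub>S\<^esub> (t \<otimes>\<^bsub>S\<^esub> u)) \<in> module_hom K S S"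
      by (rule module_hom_comp[OF mult_hom_S(1)[OF assms(3)] mult_hom_S(2)[OF pab]])
    fix c d assume cd: "c \<in> carrier A" "d \<in> carrier B"
    note pcd = pure_closed[OF cd]
    show "(pure a b \<otimes>\<^bsub>S\<^esub> pure c d) \<otimes>\<^bsub>S\<^esub> u = pure a b \<otimes>\<^bsub>S\<^esub> (pure c d \<otimes>\<^bsub>S\<^esub> u)"
    proof (rule S_hom_ext[OF module_S _ _ _ assms(3), where h = "\<lambda>u. (pure a b \<otimes>\<^bsub>S\<^esub> pure c d) \<otimes>\<^bsub>S\<^esub> u"])
      show "(\<lambda>u. (pure a b \<otimes>\<^bsub>S\<^esub> pure c d) \<otimes>\<^bsub>S\<^esub> u) \<in> module_hom K S S"
        by (intro mult_hom_S mult_closed_S pab pcd)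
      show "(\<lambda>u. pure a b \<otimes>\<^bsub>S\<^esub> (pure c d \<otimes>\<^bsub>S\<^esub> u)) \<in> module_hom K S S"
        by (rule module_hom_comp[OF mult_hom_S(2)[OF pcd] mult_hom_S(2)[OF pab]])
    qed (use ab cd mult_pure_assoc in auto)
  qed
qed

lemma pure_mult_inB:
  assumes "a \<in> carrier A" "b \<in> carrier B" "d \<in> carrier B"
  shows "pure a b \<otimes>\<^bsub>S\<^esub> inB d = pure a (b \<otimes>\<^bsub>B\<^esub> d)"
  using assms by (simp add: mult_pure sweedler_one(2)[OF module_T sandwich_bilinear])

lemma inA_mult_pure:
  assumes "a \<in> carrier A" "c \<in> carrier A" "d \<in> carrier B"
  shows "inA a \<otimes>\<^bsub>S\<^esub> pure c d = pure (a \<otimes>\<^bsub>A\<^esub> c) d"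
  using assms by (simp add: mult_pure sweedler_one(1)[OF module_T sandwich_bilinear])

lemma inA_mult_inB: "\<lbrakk>a \<in> carrier A; b \<in> carrier B\<rbrakk> \<Longrightarrow> inA a \<otimes>\<^bsub>S\<^esub> inB b = pure a b"
  by (simp add: pure_mult_inB)

lemma one_closed_S: "pure \<one>\<^bsub>A\<^esub> \<one>\<^bsub>B\<^esub> \<in> carrier S"
  by (simp add: pure_closed)

lemma id_hom_S: "(\<lambda>s. s) \<in> module_hom K S S"
  by (rule module_homI) simp_all

lemma unital_algebra_S: "unital_algebra K S"
proof (intro unital_algebra.intro unital_algebra_axioms.intro vectorspace_S)
  interpret S: module K S by (rule module_S)
  have one_l: "\<one>\<^bsub>S\<^esub> \<otimes>\<^bsub>S\<^esub> s = s" if "s \<in> carrier S" for s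
    unfolding S_simps(5)
    by (rule S_hom_ext[OF module_S mult_hom_S(2) id_hom_S _ that])
      (auto simp: one_closed_S inA_mult_pure)
  have one_r: "s \<otimes>\<^bsub>S\<^esub> \<one>\<^bsub>S\<^esub> = s" if "s \<in> carrier S" for s
    unfolding S_simps(5)
    by (rule S_hom_ext[OF module_S mult_hom_S(1) id_hom_S _ that])
      (auto simp: one_closed_S pure_mult_inB)
  show "ring S"
  proof (rule ringI)
    show "abelian_group S" by (rule S.abelian_group_axioms)
    show "Group.monoid S"
      using one_l one_r one_closed_S mult_assoc_S mult_closed_S by (intro monoidI) (auto simp: S_simps(5))
  qed (simp_all add: module_hom_add[OF mult_hom_S(1)] module_hom_add[OF mult_hom_S(2)])
  show "(r \<odot>\<^bsub>S\<^esub> x) \<otimes>\<^bsub>S\<^esub> y = r \<odot>\<^bsub>S\<^esub> (x \<otimes>\<^bsub>S\<^esub> y)"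
    and "x \<otimes>\<^bsub>S\<^esub> (r \<odot>\<^bsub>S\<^esub> y) = r \<odot>\<^bsub>S\<^esub> (x \<otimes>\<^bsub>S\<^esub> y)"
    if "r \<in> carrier K" "x \<in> carrier S" "y \<in> carrier S" for r x y
    using that by (simp_all add: module_hom_smult[OF mult_hom_S(1)] module_hom_smult[OF mult_hom_S(2)])
qed

lemma inB_mult_inA:
  assumes "b \<in> carrier B" "a \<in> carrier A"
  shows "inB b \<otimes>\<^bsub>S\<^esub> inA a = \<psi> (tens K B A b a)"
proof -
  have "inB b \<otimes>\<^bsub>S\<^esub> inA a = sweedler T (\<lambda>x y. pure x y) b a"
    using assms
    by (simp add: mult_pure) (rule sweedler_cong[OF module_T], auto simp: AB.tens_closed)
  also have "\<dots> = \<psi> (tens K B A b a)"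
    using sweedler_hom[OF module_T, of "\<lambda>x. x"] assms id_hom_S by (simp add: module_hom_S)
  finally show ?thesis .
qed

text \<open>These two lemmas turn Sweedler sums into products of \<open>S\<close>. They are how the steps of \<open>push\<close> and
  \<open>theta_step\<close> are evaluated.\<close>

lemma sweedler_hom_inB:
  assumes "module K N" "h \<in> module_hom K S N" "b \<in> carrier B" "a \<in> carrier A"
  shows "sweedler N (\<lambda>x y. h (pure x y)) b a = h (inB b \<otimes>\<^bsub>S\<^esub> inA a)"
  using assms by (simp add: sweedler_hom module_hom_S inB_mult_inA)

lemma sweedler_hom_mult:
  assumes N: "module K N" and h: "h \<in> module_hom K S N"
    and a: "a \<in> carrier A" and b: "b \<in> carrier B" and c: "c \<in> carrier A" and d: "d \<in> carrier B"
  shows "sweedler N (\<lambda>x y. h (pure (a \<otimes>\<^bsub>A\<^esub> x) (y \<otimes>\<^bsub>B\<^esub> d))) b c = h (pure a b \<otimes>\<^bsub>S\<^esub> pure c d)"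
  using assms by (simp add: mult_pure sweedler_commute[OF module_T N] module_hom_S AB.tens_closed)

end

section \<open>The tensor power over \<open>B\<close>\<close>

lemma tuples_update: "\<lbrakk>xs \<in> tuples Y n; x \<in> carrier Y\<rbrakk> \<Longrightarrow> xs[i := x] \<in> tuples Y n"
  by (auto simp: tuples_def dest: set_update_subset_insert[THEN subsetD])

lemma update_split: "i < length xs \<Longrightarrow> xs[i := x] = take i xs @ x # drop (Suc i) xs"
  by (rule upd_conv_take_nth_drop)

lemma update_split2:
  assumes "Suc i < length xs"
  shows "xs[i := x] = take i xs @ x # xs ! Suc i # drop (Suc (Suc i)) xs"
    and "xs[Suc i := y] = take i xs @ xs ! i # y # drop (Suc (Suc i)) xs"
  using assms
  by (simp_all add: update_split Cons_nth_drop_Suc take_Suc_conv_app_nth)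

context factorised
begin

text \<open>The relations of the tensor power are given by updates of a tuple. Splitting the tuple around the
  updated entry is more convenient for induction along the tuple.\<close>

definition balanced_multilinear :: "nat \<Rightarrow> ('k, 'n, 'u) module_scheme
    \<Rightarrow> (('a \<times> 'b \<Rightarrow> 'k) set list \<Rightarrow> 'n) \<Rightarrow> bool" where
  "balanced_multilinear n N f \<longleftrightarrow>
     (\<forall>pre post. set pre \<subseteq> carrier S \<and> set post \<subseteq> carrier S \<and> Suc (length pre + length post) = n \<longrightarrow>
        (\<lambda>x. f (pre @ x # post)) \<in> module_hom K S N) \<and>
     (\<forall>pre x b y post. set pre \<subseteq> carrier S \<and> x \<in> carrier S \<and> b \<in> carrier B \<and> y \<in> carrier S \<and>
        set post \<subseteq> carrier S \<and> Suc (Suc (length pre + length post)) = n \<longrightarrow>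
        f (pre @ (x \<otimes>\<^bsub>S\<^esub> inB b) # y # post) = f (pre @ x # (inB b \<otimes>\<^bsub>S\<^esub> y) # post))"

lemma balanced_multilinearD:
  assumes "balanced_multilinear n N f"
  shows "\<lbrakk>set pre \<subseteq> carrier S; set post \<subseteq> carrier S; Suc (length pre + length post) = n\<rbrakk>
      \<Longrightarrow> (\<lambda>x. f (pre @ x # post)) \<in> module_hom K S N"
    and "\<lbrakk>set pre \<subseteq> carrier S; x \<in> carrier S; b \<in> carrier B; y \<in> carrier S;
        set post \<subseteq> carrier S; Suc (Suc (length pre + length post)) = n\<rbrakk>
      \<Longrightarrow> f (pre @ (x \<otimes>\<^bsub>S\<^esub> inB b) # y # post) = f (pre @ x # (inB b \<otimes>\<^bsub>S\<^esub> y) # post)"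
  using assms unfolding balanced_multilinear_def by blast+

lemma inB_closed: "b \<in> carrier B \<Longrightarrow> inB b \<in> carrier S"
  and inA_closed: "a \<in> carrier A \<Longrightarrow> inA a \<in> carrier S"
  by (simp_all add: pure_closed)

lemma presentation_power:
  "presentation K (tuples S n) (fact_power_rels n)"
proof -
  interpret free_presentation K "tuples S n" by unfold_locales
  have nth: "xs ! i \<in> carrier S" if "xs \<in> tuples S n" "i < n" for xs i
    using that by (auto simp: tuples_def)
  have "slot_rels K (tuples S n) S {\<lambda>x. xs[i := x] | xs i. xs \<in> tuples S n \<and> i < n} \<subseteq> carrier F"
    by (intro slot_rels_closed module_S) (auto intro: tuples_update)
  moreover have "basis_elem K (tuples S n) (xs[i := xs ! i \<otimes>\<^bsub>S\<^esub> inB b])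
        \<ominus>\<^bsub>F\<^esub> basis_elem K (tuples S n) (xs[Suc i := inB b \<otimes>\<^bsub>S\<^esub> xs ! Suc i]) \<in> carrier F"
    if "xs \<in> tuples S n" "Suc i < n" "b \<in> carrier B" for xs i b
    using that
    by (intro F.minus_closed basis_closed tuples_update mult_closed_S nth inB_closed) auto
  ultimately show ?thesis
    by unfold_locales (auto simp: fact_power_rels_def tensor_power_over_rels_def)
qed

end

locale factorised_power = factorised K A B \<psi>
  for K :: "('k, 'r) ring_scheme"
    and A :: "('k, 'a, 's) module_scheme"
    and B :: "('k, 'b, 't) module_scheme"
    and \<psi> +
  fixes n :: nat
  assumes n_pos: "n \<ge> 1"
begin

sublocale FP: presentation K "tuples S n" "fact_power_rels n"
  by (rule presentation_power)

abbreviation "M \<equiv> fact_power n"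
abbreviation "ten \<equiv> fact_power_tens n"

lemma M_eq: "M = FP.P" and ten_eq: "ten xs = FP.gen xs"
  by (simp_all add: fact_power_def fact_power_tens_def)

lemma module_M: "module K M" and vectorspace_M: "vectorspace K M"
  using FP.module_P FP.vectorspace_P by (simp_all add: M_eq)

lemma tuples_append:
  "pre @ x # post \<in> tuples S n \<longleftrightarrow>
     set pre \<subseteq> carrier S \<and> x \<in> carrier S \<and> set post \<subseteq> carrier S \<and> Suc (length pre + length post) = n"
  by (auto simp: tuples_def)

lemma tuples_split:
  assumes "xs \<in> tuples S n" "i < n"
  shows "set (take i xs) \<subseteq> carrier S" "set (drop i xs) \<subseteq> carrier S" "xs ! i \<in> carrier S"
    "length xs = n"
  using assms by (auto simp: tuples_def dest: in_set_takeD in_set_dropD)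

lemma balanced_multilinear_closed:
  assumes f: "balanced_multilinear n N f" and xs: "xs \<in> tuples S n"
  shows "f xs \<in> carrier N"
proof -
  obtain x ys where "xs = [] @ x # ys" using xs n_pos by (cases xs) (auto simp: tuples_def)
  then show ?thesis
    using module_hom_in[OF balanced_multilinearD(1)[OF f, of "[]" ys]] xs by (simp add: tuples_def)
qed

lemma compatible_power:
  assumes N: "module K N" and f: "balanced_multilinear n N f"
  shows "FP.compatible N f"
  unfolding FP.compatible_def
proof (intro conjI ballI)
  show c: "f xs \<in> carrier N" if "xs \<in> tuples S n" for xs
    using balanced_multilinear_closed[OF f that] .
  fix p assume "p \<in> fact_power_rels n"
  then consider
    (slot) "p \<in> slot_rels K (tuples S n) S {\<lambda>x. xs[i := x] | xs i. xs \<in> tuples S n \<and> i < n}"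
  | (bal) xs i b where "xs \<in> tuples S n" "Suc i < n" "b \<in> carrier B"
      "p = basis_elem K (tuples S n) (xs[i := xs ! i \<otimes>\<^bsub>S\<^esub> inB b])
        \<ominus>\<^bsub>FP.F\<^esub> basis_elem K (tuples S n) (xs[Suc i := inB b \<otimes>\<^bsub>S\<^esub> xs ! Suc i])"
    unfolding fact_power_rels_def tensor_power_over_rels_def by blast
  then show "lin_sum K (tuples S n) N f p = \<zero>\<^bsub>N\<^esub>"
  proof cases
    case slot
    show ?thesis
    proof (rule FP.lin_sum_slot_rels[OF module_S N _ _ _ slot])
      fix j assume "j \<in> {\<lambda>x. xs[i := x] | xs i. xs \<in> tuples S n \<and> i < n}"
      then obtain xs i where j: "j = (\<lambda>x. xs[i := x])" "xs \<in> tuples S n" "i < n" by blast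
      have l: "length xs = n" using j by (simp add: tuples_def)
      then have e: "j x = take i xs @ x # drop (Suc i) xs" for x
        using j by (simp add: update_split)
      note s = tuples_split[OF j(2)]
      have d: "set (drop (Suc i) xs) \<subseteq> carrier S"
        using j(2) by (auto simp: tuples_def dest: in_set_dropD)
      show "j u \<in> tuples S n" if "u \<in> carrier S" for u
        unfolding e tuples_append using that s d j(3) l by auto
      show "(\<lambda>u. f (j u)) \<in> module_hom K S N"
        unfolding e using s[OF j(3)] d j(3) by (intro balanced_multilinearD(1)[OF f]) auto
    qed (use c in auto)
  next
    case bal
    let ?pre = "take i xs" and ?post = "drop (Suc (Suc i)) xs"
    let ?u = "?pre @ (xs ! i \<otimes>\<^bsub>S\<^esub> inB b) # xs ! Suc i # ?post"
    let ?v = "?pre @ xs ! i # (inB b \<otimes>\<^bsub>S\<^esub> xs ! Suc i) # ?post"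
    have l: "length xs = n" using bal by (simp add: tuples_def)
    note s = tuples_split[OF bal(1)]
    have s': "set ?pre \<subseteq> carrier S" "xs ! i \<in> carrier S" "xs ! Suc i \<in> carrier S" "set ?post \<subseteq> carrier S"
      using s(1,3)[of i] s(3)[of "Suc i"] bal(1,2) by (auto simp: tuples_def dest: in_set_dropD)
    have uv: "?u \<in> tuples S n" "?v \<in> tuples S n"
      unfolding tuples_append using s' bal(2,3) l by (auto simp: inB_closed mult_closed_S)
    have "p = basis_elem K (tuples S n) ?u \<ominus>\<^bsub>FP.F\<^esub> basis_elem K (tuples S n) ?v"
      using bal(2) l by (simp add: bal(4) update_split2)
    moreover have "f ?u = f ?v"
      using s' bal(2,3) l by (intro balanced_multilinearD(2)[OF f]) auto
    ultimately show ?thesis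
      using c uv by (simp only:) (rule FP.lin_sum_basis_diff[OF N]; simp)
  qed
qed

lemma power_ext_hom:
  "\<lbrakk>module K N; balanced_multilinear n N f\<rbrakk> \<Longrightarrow> lin_ext K (tuples S n) N f \<in> module_hom K M N"
  unfolding M_eq by (intro FP.lin_ext_hom compatible_power)

lemma power_ext_ten:
  "\<lbrakk>module K N; balanced_multilinear n N f; xs \<in> tuples S n\<rbrakk> \<Longrightarrow> lin_ext K (tuples S n) N f (ten xs) = f xs"
  unfolding ten_eq by (intro FP.lin_ext_gen compatible_power)

lemma power_hom_ext:
  assumes "module K N" "h \<in> module_hom K M N" "g \<in> module_hom K M N"
    and "\<And>xs. xs \<in> tuples S n \<Longrightarrow> h (ten xs) = g (ten xs)" and "t \<in> carrier M"
  shows "h t = g t"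
  using assms by (intro FP.hom_ext[of N h g t]) (simp_all add: M_eq ten_eq)

lemma ten_closed: "xs \<in> tuples S n \<Longrightarrow> ten xs \<in> carrier M"
  by (simp add: M_eq ten_eq FP.gen_closed)

lemma ten_balanced_multilinear: "balanced_multilinear n M ten"
  unfolding balanced_multilinear_def
proof (intro conjI allI impI; elim conjE)
  fix pre post assume *: "set pre \<subseteq> carrier S" "set post \<subseteq> carrier S" "Suc (length pre + length post) = n"
  \<comment> \<open>the entry \<open>\<zero>\<close> is a placeholder, which the update replaces by \<open>x\<close>\<close>
  let ?xs = "pre @ \<zero>\<^bsub>S\<^esub> # post"
  interpret S: module K S by (rule module_S)
  have xs: "?xs \<in> tuples S n" "length pre < n" using * by (auto simp: tuples_append)
  have j: "(\<lambda>x. ?xs[length pre := x]) \<in> {\<lambda>x. xs[i := x] | xs i. xs \<in> tuples S n \<and> i < n}"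
    using xs by blast
  have "(\<lambda>x. FP.gen (?xs[length pre := x])) \<in> module_hom K S FP.P"
    by (rule FP.gen_slot_hom[OF module_S _ _ j])
      (use * in \<open>auto simp: tuples_append fact_power_rels_def tensor_power_over_rels_def\<close>)
  then show "(\<lambda>x. ten (pre @ x # post)) \<in> module_hom K S M" by (simp add: M_eq ten_eq)
next
  fix pre x b y post
  assume *: "set pre \<subseteq> carrier S" "x \<in> carrier S" "b \<in> carrier B" "y \<in> carrier S"
    "set post \<subseteq> carrier S" "Suc (Suc (length pre + length post)) = n"
  let ?xs = "pre @ x # y # post"
  let ?u = "pre @ (x \<otimes>\<^bsub>S\<^esub> inB b) # y # post" and ?v = "pre @ x # (inB b \<otimes>\<^bsub>S\<^esub> y) # post"
  have uv: "?xs \<in> tuples S n" "?u \<in> tuples S n" "?v \<in> tuples S n"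
    using * by (auto simp: tuples_append inB_closed mult_closed_S)
  have "basis_elem K (tuples S n) ?u \<ominus>\<^bsub>FP.F\<^esub> basis_elem K (tuples S n) ?v \<in> fact_power_rels n"
    unfolding fact_power_rels_def tensor_power_over_rels_def
    by (rule UnI2, rule CollectI, rule exI[of _ ?xs], rule exI[of _ "length pre"], rule exI[of _ b])
      (use * uv(1) in \<open>simp add: list_update_append nth_append\<close>)
  then show "ten ?u = ten ?v"
    unfolding ten_eq FP.gen_eq using uv by (intro FP.cls_eq_of_diff FP.basis_closed)
qed

lemmas ten_hom = balanced_multilinearD(1)[OF ten_balanced_multilinear]
lemmas ten_balanced = balanced_multilinearD(2)[OF ten_balanced_multilinear]

subsection \<open>The two actions\<close>

abbreviation "lact \<equiv> fact_power_lact n"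
abbreviation "ract \<equiv> fact_power_ract n"

text \<open>The only relation over \<open>B\<close> that is affected is the one between the first two factors, where the claim is
  \<open>s (x b) = (s x) b\<close>.\<close>

lemma lact_balanced_multilinear:
  assumes s: "s \<in> carrier S"
  shows "balanced_multilinear n M (\<lambda>xs. ten (xs[0 := s \<otimes>\<^bsub>S\<^esub> (xs ! 0)]))" (is "balanced_multilinear n M ?f")
  unfolding balanced_multilinear_def
proof (intro conjI allI impI; elim conjE)
  fix pre post assume *: "set pre \<subseteq> carrier S" "set post \<subseteq> carrier S" "Suc (length pre + length post) = n"
  show "(\<lambda>x. ?f (pre @ x # post)) \<in> module_hom K S M"
  proof (cases pre)
    case Nil
    then show ?thesis
      using * module_hom_comp[OF mult_hom_S(2)[OF s] ten_hom[of "[]" post]] by simp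
  next
    case (Cons p pre')
    then show ?thesis
      using * s ten_hom[of "(s \<otimes>\<^bsub>S\<^esub> p) # pre'" post] by (simp add: mult_closed_S)
  qed
next
  fix pre x b y post
  assume *: "set pre \<subseteq> carrier S" "x \<in> carrier S" "b \<in> carrier B" "y \<in> carrier S"
    "set post \<subseteq> carrier S" "Suc (Suc (length pre + length post)) = n"
  show "?f (pre @ (x \<otimes>\<^bsub>S\<^esub> inB b) # y # post) = ?f (pre @ x # (inB b \<otimes>\<^bsub>S\<^esub> y) # post)"
  proof (cases pre)
    case Nil
    then show ?thesis
      using * s ten_balanced[of "[]" "s \<otimes>\<^bsub>S\<^esub> x" b y post]
      by (simp add: mult_closed_S mult_assoc_S inB_closed)
  next
    case (Cons p pre')
    then show ?thesis
      using * s ten_balanced[of "(s \<otimes>\<^bsub>S\<^esub> p) # pre'" x b y post] by (simp add: mult_closed_S)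
  qed
qed

text \<open>The only relation over \<open>B\<close> that is affected is the one between the last two factors, where the claim is
  \<open>(b y) s = b (y s)\<close>.\<close>

lemma ract_balanced_multilinear:
  assumes s: "s \<in> carrier S"
  shows "balanced_multilinear n M (\<lambda>xs. ten (xs[n - 1 := (xs ! (n - 1)) \<otimes>\<^bsub>S\<^esub> s]))"
    (is "balanced_multilinear n M ?f")
proof -
  have "?f (ys @ [z]) = ten (ys @ [z \<otimes>\<^bsub>S\<^esub> s])" if "Suc (length ys) = n" for ys z
    using that[symmetric] by simp
  note f = this[unfolded One_nat_def]
  show ?thesis
    unfolding balanced_multilinear_def
  proof (intro conjI allI impI; elim conjE)
    fix pre post assume *: "set pre \<subseteq> carrier S" "set post \<subseteq> carrier S" "Suc (length pre + length post) = n"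
    show "(\<lambda>x. ?f (pre @ x # post)) \<in> module_hom K S M"
    proof (cases post rule: rev_cases)
      case Nil
      then show ?thesis
        using * module_hom_comp[OF mult_hom_S(1)[OF s] ten_hom[of pre "[]"]] by (simp add: f)
    next
      case (snoc post' z)
      then show ?thesis
        using * s ten_hom[of pre "post' @ [z \<otimes>\<^bsub>S\<^esub> s]"] f[of "pre @ _ # post'" z]
        by (simp add: mult_closed_S)
    qed
  next
    fix pre x b y post
    assume *: "set pre \<subseteq> carrier S" "x \<in> carrier S" "b \<in> carrier B" "y \<in> carrier S"
      "set post \<subseteq> carrier S" "Suc (Suc (length pre + length post)) = n"
    show "?f (pre @ (x \<otimes>\<^bsub>S\<^esub> inB b) # y # post) = ?f (pre @ x # (inB b \<otimes>\<^bsub>S\<^esub> y) # post)"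
    proof (cases post rule: rev_cases)
      case Nil
      then show ?thesis
        using * s ten_balanced[of pre x b "y \<otimes>\<^bsub>S\<^esub> s" "[]"] f[of "pre @ [_]" _]
        by (simp add: mult_closed_S mult_assoc_S inB_closed)
    next
      case (snoc post' z)
      then show ?thesis
        using * s ten_balanced[of pre x b y "post' @ [z \<otimes>\<^bsub>S\<^esub> s]"] f[of "pre @ _ # _ # post'" z]
        by (simp add: mult_closed_S)
    qed
  qed
qed

lemma lact_hom: "s \<in> carrier S \<Longrightarrow> lact s \<in> module_hom K M M"
  unfolding fact_power_lact_def by (intro power_ext_hom module_M lact_balanced_multilinear)

lemma ract_hom: "s \<in> carrier S \<Longrightarrow> (\<lambda>x. ract x s) \<in> module_hom K M M"
  unfolding fact_power_ract_def by (intro power_ext_hom module_M ract_balanced_multilinear)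

lemma lact_ten:
  assumes "s \<in> carrier S" "x # xs \<in> tuples S n"
  shows "lact s (ten (x # xs)) = ten ((s \<otimes>\<^bsub>S\<^esub> x) # xs)"
  unfolding fact_power_lact_def
  using power_ext_ten[OF module_M lact_balanced_multilinear[OF assms(1)] assms(2)] by simp

lemma ract_ten:
  assumes "s \<in> carrier S" "xs @ [x] \<in> tuples S n"
  shows "ract (ten (xs @ [x])) s = ten (xs @ [x \<otimes>\<^bsub>S\<^esub> s])"
proof -
  have "n - 1 = length xs" using assms(2) by (auto simp: tuples_def)
  then show ?thesis
    unfolding fact_power_ract_def
    using power_ext_ten[OF module_M ract_balanced_multilinear[OF assms(1)] assms(2)] by simp
qed

lemma lact_hom_scalar:
  assumes "x \<in> carrier M"
  shows "(\<lambda>s. lact s x) \<in> module_hom K S M"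
  unfolding fact_power_lact_def
proof (rule FP.lin_ext_param[OF module_M])
  fix xs assume "xs \<in> tuples S n"
  then obtain y ys where xs: "xs = y # ys" "y \<in> carrier S" "set ys \<subseteq> carrier S" "Suc (length ys) = n"
    using n_pos by (cases xs) (auto simp: tuples_def)
  show "(\<lambda>s. ten (xs[0 := s \<otimes>\<^bsub>S\<^esub> xs ! 0])) \<in> module_hom K S M"
    using module_hom_comp[OF mult_hom_S(1)[OF xs(2)] ten_hom[of "[]" ys]] xs by simp
qed (use assms M_eq in simp)

lemma ract_hom_scalar:
  assumes "x \<in> carrier M"
  shows "ract x \<in> module_hom K S M"
  unfolding fact_power_ract_def[abs_def]
proof (rule FP.lin_ext_param[OF module_M])
  fix xs assume "xs \<in> tuples S n"
  then obtain ys y where xs: "xs = ys @ [y]" "y \<in> carrier S" "set ys \<subseteq> carrier S" "Suc (length ys) = n"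
    using n_pos by (cases xs rule: rev_cases) (auto simp: tuples_def)
  then have "n - 1 = length ys" by simp
  then show "(\<lambda>s. ten (xs[n - 1 := xs ! (n - 1) \<otimes>\<^bsub>S\<^esub> s])) \<in> module_hom K S M"
    using module_hom_comp[OF mult_hom_S(2)[OF xs(2)] ten_hom[of ys "[]"]] xs by simp
qed (use assms M_eq in simp)

lemma tuples_ConsE:
  assumes "xs \<in> tuples S n"
  obtains y ys where "xs = y # ys" "y \<in> carrier S" "set ys \<subseteq> carrier S" "Suc (length ys) = n"
  using assms n_pos by (cases xs) (auto simp: tuples_def)

lemma tuples_snocE:
  assumes "xs \<in> tuples S n"
  obtains ys y where "xs = ys @ [y]" "y \<in> carrier S" "set ys \<subseteq> carrier S" "Suc (length ys) = n"
  using assms n_pos by (cases xs rule: rev_cases) (auto simp: tuples_def)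

lemma tuples_Cons: "x # xs \<in> tuples S n \<longleftrightarrow> x \<in> carrier S \<and> set xs \<subseteq> carrier S \<and> Suc (length xs) = n"
  by (auto simp: tuples_def)

lemma tuples_snoc: "xs @ [x] \<in> tuples S n \<longleftrightarrow> x \<in> carrier S \<and> set xs \<subseteq> carrier S \<and> Suc (length xs) = n"
  by (auto simp: tuples_def)

lemma id_hom_M: "(\<lambda>x. x) \<in> module_hom K M M"
  by (rule module_homI) simp_all

text \<open>Beyond linearity, each axiom is an identity of linear maps and is checked on generators, where
  it reduces to the unit law or associativity of \<open>S\<close>. The two actions commute for \<open>n \<ge> 2\<close> because they concern different
  factors; for \<open>n = 1\<close> this is again associativity.\<close>

lemma bimodule_M: "bimodule K S M lact ract"
proof (intro bimodule.intro bimodule_axioms.intro unital_algebra_S vectorspace_M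
    lact_hom lact_hom_scalar ract_hom ract_hom_scalar)
  interpret SA: unital_algebra K S by (rule unital_algebra_S)
  show "lact \<one>\<^bsub>S\<^esub> x = x" if "x \<in> carrier M" for x
  proof (rule power_hom_ext[OF module_M lact_hom id_hom_M _ that])
    show "lact \<one>\<^bsub>S\<^esub> (ten xs) = ten xs" if "xs \<in> tuples S n" for xs
      using that by (elim tuples_ConsE) (simp add: lact_ten tuples_Cons)
  qed simp
  show "ract x \<one>\<^bsub>S\<^esub> = x" if "x \<in> carrier M" for x
  proof (rule power_hom_ext[OF module_M ract_hom id_hom_M _ that])
    show "ract (ten xs) \<one>\<^bsub>S\<^esub> = ten xs" if "xs \<in> tuples S n" for xs
      using that by (elim tuples_snocE) (simp add: ract_ten tuples_snoc)
  qed simp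
  fix s t x assume s: "s \<in> carrier S" and t: "t \<in> carrier S" and x: "x \<in> carrier M"
  note st = mult_closed_S[OF s t]
  show "lact (s \<otimes>\<^bsub>S\<^esub> t) x = lact s (lact t x)"
  proof (rule power_hom_ext[OF module_M lact_hom[OF st] module_hom_comp[OF lact_hom[OF t] lact_hom[OF s]] _ x])
    show "lact (s \<otimes>\<^bsub>S\<^esub> t) (ten xs) = lact s (lact t (ten xs))" if "xs \<in> tuples S n" for xs
      using that s t by (elim tuples_ConsE) (simp add: lact_ten tuples_Cons mult_closed_S mult_assoc_S)
  qed
  show "ract x (s \<otimes>\<^bsub>S\<^esub> t) = ract (ract x s) t"
  proof (rule power_hom_ext[OF module_M ract_hom[OF st] module_hom_comp[OF ract_hom[OF s] ract_hom[OF t]] _ x])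
    show "ract (ten xs) (s \<otimes>\<^bsub>S\<^esub> t) = ract (ract (ten xs) s) t" if "xs \<in> tuples S n" for xs
      using that s t by (elim tuples_snocE) (simp add: ract_ten tuples_snoc mult_closed_S mult_assoc_S)
  qed
  show "ract (lact s x) t = lact s (ract x t)"
  proof (rule power_hom_ext[OF module_M module_hom_comp[OF lact_hom[OF s] ract_hom[OF t]]
        module_hom_comp[OF ract_hom[OF t] lact_hom[OF s]] _ x])
    show "ract (lact s (ten xs)) t = lact s (ract (ten xs) t)" if xs: "xs \<in> tuples S n" for xs
    proof -
      obtain y ys where y: "xs = y # ys" "y \<in> carrier S" "set ys \<subseteq> carrier S" "Suc (length ys) = n"
        using xs by (rule tuples_ConsE)
      show ?thesis
      proof (cases ys rule: rev_cases)
        case Nil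
        then show ?thesis
          using y s t lact_ten[of s _ "[]"] ract_ten[of t "[]"]
          by (simp add: tuples_Cons mult_closed_S mult_assoc_S)
      next
        case (snoc zs z)
        then show ?thesis
          using y s t lact_ten[of s y "zs @ [_]"] ract_ten[of t "_ # zs" z]
          by (simp add: tuples_Cons mult_closed_S)
      qed
    qed
  qed
qed

end

context factorised
begin

lemma presentation_power_times:
  "presentation K (tuples A n \<times> carrier B) (tensor_power_times_rels K A B n)"
proof -
  interpret free_presentation K "tuples A n \<times> carrier B" by unfold_locales
  have "slot_rels K (tuples A n \<times> carrier B) A
      {\<lambda>a. (as[i := a], b) | as i b. as \<in> tuples A n \<and> i < n \<and> b \<in> carrier B} \<subseteq> carrier F"
    by (intro slot_rels_closed module_A) (auto intro: tuples_update)
  moreover have "slot_rels K (tuples A n \<times> carrier B) B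
      {\<lambda>b. (as, b) | as. as \<in> tuples A n} \<subseteq> carrier F"
    by (intro slot_rels_closed module_B) auto
  ultimately show ?thesis
    by unfold_locales (simp add: tensor_power_times_rels_def)
qed

end

context factorised_power
begin

section \<open>The space \<open>A \<otimes> \<dots> \<otimes> A \<otimes> B\<close>\<close>

sublocale PT: presentation K "tuples A n \<times> carrier B" "tensor_power_times_rels K A B n"
  by (rule presentation_power_times)

abbreviation "N \<equiv> power_times n"
abbreviation "pten \<equiv> power_times_tens n"

lemma N_eq: "N = PT.P" and pten_eq: "pten as b = PT.gen (as, b)"
  by (simp_all add: power_times_def power_times_tens_def)

lemma module_N: "module K N" and vectorspace_N: "vectorspace K N"
  using PT.module_P PT.vectorspace_P by (simp_all add: N_eq)

lemma pten_closed: "\<lbrakk>as \<in> tuples A n; b \<in> carrier B\<rbrakk> \<Longrightarrow> pten as b \<in> carrier N"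
  by (simp add: N_eq pten_eq PT.gen_closed)

lemma pten_hom_A:
  assumes "as \<in> tuples A n" "i < n" "b \<in> carrier B"
  shows "(\<lambda>a. pten (as[i := a]) b) \<in> module_hom K A N"
proof -
  have j: "(\<lambda>a. (as[i := a], b)) \<in> {\<lambda>a. (as[i := a], b) | as i b. as \<in> tuples A n \<and> i < n \<and> b \<in> carrier B}"
    using assms by blast
  have "(\<lambda>a. PT.gen (as[i := a], b)) \<in> module_hom K A PT.P"
    by (rule PT.gen_slot_hom[OF module_A _ _ j])
      (use assms in \<open>auto simp: tuples_update tensor_power_times_rels_def\<close>)
  then show ?thesis by (simp add: N_eq pten_eq)
qed

lemma pten_hom_B:
  assumes "as \<in> tuples A n"
  shows "(\<lambda>b. pten as b) \<in> module_hom K B N"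
proof -
  have j: "(\<lambda>b. (as, b)) \<in> {\<lambda>b. (as, b) | as. as \<in> tuples A n}"
    using assms by blast
  have "(\<lambda>b. PT.gen (as, b)) \<in> module_hom K B PT.P"
    by (rule PT.gen_slot_hom[OF module_B _ _ j])
      (use assms in \<open>auto simp: tensor_power_times_rels_def\<close>)
  then show ?thesis by (simp add: N_eq pten_eq)
qed

lemma compatible_power_times:
  assumes N: "module K N'"
    and c: "\<And>as b. \<lbrakk>as \<in> tuples A n; b \<in> carrier B\<rbrakk> \<Longrightarrow> f as b \<in> carrier N'"
    and fA: "\<And>as b i. \<lbrakk>as \<in> tuples A n; b \<in> carrier B; i < n\<rbrakk> \<Longrightarrow> (\<lambda>a. f (as[i := a]) b) \<in> module_hom K A N'"
    and fB: "\<And>as. as \<in> tuples A n \<Longrightarrow> (\<lambda>b. f as b) \<in> module_hom K B N'"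
  shows "PT.compatible N' (\<lambda>(as, b). f as b)"
  unfolding PT.compatible_def
proof (intro conjI ballI)
  show c': "(case x of (as, b) \<Rightarrow> f as b) \<in> carrier N'" if "x \<in> tuples A n \<times> carrier B" for x
    using that c by auto
  fix p assume "p \<in> tensor_power_times_rels K A B n"
  then consider "p \<in> slot_rels K (tuples A n \<times> carrier B) A
      {\<lambda>a. (as[i := a], b) | as i b. as \<in> tuples A n \<and> i < n \<and> b \<in> carrier B}"
    | "p \<in> slot_rels K (tuples A n \<times> carrier B) B {\<lambda>b. (as, b) | as. as \<in> tuples A n}"
    unfolding tensor_power_times_rels_def by blast
  then show "lin_sum K (tuples A n \<times> carrier B) N' (\<lambda>(as, b). f as b) p = \<zero>\<^bsub>N'\<^esub>"
  proof cases
    case 1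
    then show ?thesis
      by (rule PT.lin_sum_slot_rels[OF module_A N, rotated -1])
        (use c' fA in \<open>auto simp: tuples_update\<close>)
  next
    case 2
    then show ?thesis
      by (rule PT.lin_sum_slot_rels[OF module_B N, rotated -1]) (use c' fB in auto)
  qed
qed

section \<open>The inverse of \<open>\<theta>\<close>\<close>

text \<open>The value of \<open>\<phi>\<close> on generators. Letting \<open>b\<close> act from the right, instead of writing it into
  the last factor, makes linearity in \<open>b\<close> and the effect of \<open>push\<close>, which only carries its last argument
  along, immediate; \<open>phi_gen_snoc\<close> gives the other form.\<close>

definition phi_gen :: "'a list \<Rightarrow> 'b \<Rightarrow> (('a \<times> 'b \<Rightarrow> 'k) set list \<Rightarrow> 'k) set" where
  "phi_gen as b = ract (ten (map inA as)) (inB b)"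

definition phi :: "('a list \<times> 'b \<Rightarrow> 'k) set \<Rightarrow> (('a \<times> 'b \<Rightarrow> 'k) set list \<Rightarrow> 'k) set" where
  "phi = lin_ext K (tuples A n \<times> carrier B) M (\<lambda>(as, b). phi_gen as b)"

lemma inA_hom: "inA \<in> module_hom K A S"
  using pure_comp_hom_left[of "\<lambda>x. x" A "\<one>\<^bsub>B\<^esub>"] by (simp add: module_hom_S module_homI)

lemma inB_hom: "inB \<in> module_hom K B S"
  using pure_comp_hom_right[of "\<lambda>x. x" B "\<one>\<^bsub>A\<^esub>"] by (simp add: module_hom_S module_homI)

lemma map_inA_closed: "set as \<subseteq> carrier A \<Longrightarrow> set (map inA as) \<subseteq> carrier S"
  by (auto intro: inA_closed)

lemma map_inA_tuples: "as \<in> tuples A n \<Longrightarrow> map inA as \<in> tuples S n"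
  using map_inA_closed by (auto simp: tuples_def)

lemma phi_gen_closed: "\<lbrakk>as \<in> tuples A n; b \<in> carrier B\<rbrakk> \<Longrightarrow> phi_gen as b \<in> carrier M"
  unfolding phi_gen_def
  by (intro module_hom_in[OF ract_hom] ten_closed map_inA_tuples inB_closed)

lemma phi_compatible: "PT.compatible M (\<lambda>(as, b). phi_gen as b)"
proof (rule compatible_power_times[OF module_M phi_gen_closed])
  fix as b i assume as: "as \<in> tuples A n" and b: "b \<in> carrier B" and i: "i < n"
  have l: "length as = n" using as by (simp add: tuples_def)
  have "set (take i (map inA as)) \<subseteq> carrier S" "set (drop (Suc i) (map inA as)) \<subseteq> carrier S"
    using as by (auto simp: tuples_def take_map drop_map intro!: inA_closed dest: in_set_takeD in_set_dropD)
  then have "(\<lambda>a. ten (take i (map inA as) @ inA a # drop (Suc i) (map inA as))) \<in> module_hom K A M"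
    using i l by (intro module_hom_comp[OF inA_hom ten_hom]) auto
  then have "(\<lambda>a. ten (map inA (as[i := a]))) \<in> module_hom K A M"
    using i l by (simp add: map_update update_split take_map drop_map)
  then show "(\<lambda>a. phi_gen (as[i := a]) b) \<in> module_hom K A M"
    unfolding phi_gen_def by (rule module_hom_comp[OF _ ract_hom[OF inB_closed[OF b]]])
next
  fix as assume as: "as \<in> tuples A n"
  show "(\<lambda>b. phi_gen as b) \<in> module_hom K B M"
    unfolding phi_gen_def
    by (rule module_hom_comp[OF inB_hom ract_hom_scalar[OF ten_closed[OF map_inA_tuples[OF as]]]])
qed

lemma phi_hom: "phi \<in> module_hom K N M"
  unfolding phi_def N_eq by (rule PT.lin_ext_hom[OF module_M phi_compatible])

lemma phi_pten: "\<lbrakk>as \<in> tuples A n; b \<in> carrier B\<rbrakk> \<Longrightarrow> phi (pten as b) = phi_gen as b"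
  unfolding phi_def pten_eq using PT.lin_ext_gen[OF module_M phi_compatible] by simp

lemma phi_gen_snoc:
  assumes "set as \<subseteq> carrier A" "a \<in> carrier A" "b \<in> carrier B" "Suc (length as) = n"
  shows "phi_gen (as @ [a]) b = ten (map inA as @ [pure a b])"
  using assms map_inA_closed[OF assms(1)]
  by (simp add: phi_gen_def ract_ten tuples_snoc inA_closed inB_closed inA_mult_inB)

text \<open>Since \<open>a \<otimes> b = (a \<otimes> 1)(1 \<otimes> b)\<close>, this is the relation over \<open>B\<close>. It is the step that removes \<open>\<psi>\<close>:
  moving \<open>b\<close> past the next factor amounts to not having moved it out of the previous one.\<close>

lemma ten_move_right:
  assumes "set xs \<subseteq> carrier S" "a \<in> carrier A" "b \<in> carrier B" "y \<in> carrier S" "set ys \<subseteq> carrier S"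
    and "Suc (Suc (length xs + length ys)) = n"
  shows "ten (xs @ inA a # (inB b \<otimes>\<^bsub>S\<^esub> y) # ys) = ten (xs @ pure a b # y # ys)"
  using assms ten_balanced[of xs "inA a" b y ys] by (simp add: inA_closed inA_mult_inB)

lemma push_closed:
  "\<lbrakk>set as \<subseteq> carrier A; b \<in> carrier B; set xs \<subseteq> carrier A; c \<in> carrier B; length as + length xs = n\<rbrakk>
    \<Longrightarrow> push n as b xs c \<in> carrier N"
proof (induction xs arbitrary: as b)
  case Nil then show ?case by (simp add: pten_closed tuples_def)
next
  case (Cons x xs)
  then show ?case by (simp del: not_add_less1) (intro sweedler_closed module_N Cons.IH; simp)
qed

text \<open>By induction, each step being a Sweedler sum of a linear function of the next factor, hence the
  value of that function at \<open>(1 \<otimes> b)(x \<otimes> 1)\<close>; then \<open>1 \<otimes> b\<close> is handed back to the previous factor.\<close>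

lemma phi_push:
  "\<lbrakk>set as \<subseteq> carrier A; a \<in> carrier A; b \<in> carrier B; set xs \<subseteq> carrier A; c \<in> carrier B;
     Suc (length as + length xs) = n\<rbrakk>
    \<Longrightarrow> phi (push n (as @ [a]) b xs c) = ract (ten (map inA as @ pure a b # map inA xs)) (inB c)"
proof (induction xs arbitrary: as a b)
  case Nil
  then show ?case
    using map_inA_closed[of as]
    by (simp add: phi_pten phi_gen_snoc tuples_def ract_ten tuples_snoc inB_closed pure_closed pure_mult_inB)
next
  case (Cons x xs)
  let ?h = "\<lambda>s. ract (ten (map inA (as @ [a]) @ s # map inA xs)) (inB c)"
  have h: "?h \<in> module_hom K S M"
    using Cons.prems map_inA_closed[of "as @ [a]"] map_inA_closed[of xs]
    by (intro module_hom_comp[OF ten_hom ract_hom] inB_closed) auto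
  have "phi (push n (as @ [a]) b (x # xs) c)
      = sweedler M (\<lambda>y d. phi (push n ((as @ [a]) @ [y]) d xs c)) b x"
    using Cons.prems by (simp only: push.simps, intro sweedler_commute[OF module_N module_M phi_hom] push_closed) auto
  also have "\<dots> = sweedler M (\<lambda>y d. ?h (pure y d)) b x"
  proof (intro sweedler_cong[OF module_M])
    show "phi (push n ((as @ [a]) @ [y]) d xs c) = ?h (pure y d)" if "y \<in> carrier A" "d \<in> carrier B" for y d
      using Cons.prems that by (intro Cons.IH) auto
  qed (use Cons.prems module_hom_in[OF h] pure_closed in auto)
  also have "\<dots> = ?h (inB b \<otimes>\<^bsub>S\<^esub> inA x)"
    using Cons.prems by (intro sweedler_hom_inB[OF module_M h]) auto
  also have "\<dots> = ract (ten (map inA as @ pure a b # map inA (x # xs))) (inB c)"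
    using Cons.prems ten_move_right[of "map inA as" a b "inA x" "map inA xs"]
      map_inA_closed[of as] map_inA_closed[of xs] by (simp add: inA_closed)
  finally show ?case .
qed

lemma theta_step_closed:
  "\<lbrakk>set as \<subseteq> carrier A; c \<in> carrier B; set ps \<subseteq> carrier A \<times> carrier B; length as + length ps = n\<rbrakk>
    \<Longrightarrow> theta_step n as c ps \<in> carrier N"
proof (induction ps arbitrary: as c)
  case Nil then show ?case by (simp add: pten_closed tuples_def)
next
  case (Cons p ps)
  then show ?case by (cases p) (simp, intro sweedler_closed module_N Cons.IH; simp)
qed

lemma map_pure_closed: "set ps \<subseteq> carrier A \<times> carrier B \<Longrightarrow> set (map (\<lambda>(a, b). pure a b) ps) \<subseteq> carrier S"
  by (auto intro!: pure_closed)

text \<open>The argument is that of \<open>phi_push\<close>, with the factor \<open>x \<otimes> d\<close> in place of \<open>x \<otimes> 1\<close>.\<close>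

lemma phi_theta_step:
  "\<lbrakk>set as \<subseteq> carrier A; a \<in> carrier A; c \<in> carrier B; set ps \<subseteq> carrier A \<times> carrier B;
     Suc (length as + length ps) = n\<rbrakk>
    \<Longrightarrow> phi (theta_step n (as @ [a]) c ps) = ten (map inA as @ pure a c # map (\<lambda>(a, b). pure a b) ps)"
proof (induction ps arbitrary: as a c)
  case Nil
  then show ?case by (simp add: phi_pten phi_gen_snoc tuples_def)
next
  case (Cons p ps)
  obtain x d where p: "p = (x, d)" "x \<in> carrier A" "d \<in> carrier B" using Cons.prems(4) by (cases p) auto
  have ps: "set ps \<subseteq> carrier A \<times> carrier B" "set (map (\<lambda>(a, b). pure a b) ps) \<subseteq> carrier S"
    using Cons.prems(4) map_pure_closed[of ps] by auto
  have asa: "set (map inA (as @ [a])) \<subseteq> carrier S" "set (map inA as) \<subseteq> carrier S"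
    using Cons.prems map_inA_closed[of "as @ [a]"] map_inA_closed[of as] by auto
  let ?h = "\<lambda>s. ten (map inA (as @ [a]) @ s # map (\<lambda>(a, b). pure a b) ps)"
  have h: "?h \<in> module_hom K S M"
    using Cons.prems(5) asa ps(2) by (intro ten_hom) auto
  have "phi (theta_step n (as @ [a]) c (p # ps))
      = sweedler M (\<lambda>y e. phi (theta_step n ((as @ [a]) @ [y]) (e \<otimes>\<^bsub>B\<^esub> d) ps)) c x"
    unfolding theta_step.simps p fst_conv snd_conv
    using Cons.prems p ps(1) by (intro sweedler_commute[OF module_N module_M phi_hom] theta_step_closed) auto
  \<comment> \<open>the factor \<open>\<one>\<close> is inserted to match the product \<open>(1 \<otimes> c)(x \<otimes> d)\<close>\<close>
  also have "\<dots> = sweedler M (\<lambda>y e. ?h (pure (\<one>\<^bsub>A\<^esub> \<otimes>\<^bsub>A\<^esub> y) (e \<otimes>\<^bsub>B\<^esub> d))) c x"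
  proof (intro sweedler_cong[OF module_M])
    show "phi (theta_step n ((as @ [a]) @ [y]) (e \<otimes>\<^bsub>B\<^esub> d) ps) = ?h (pure (\<one>\<^bsub>A\<^esub> \<otimes>\<^bsub>A\<^esub> y) (e \<otimes>\<^bsub>B\<^esub> d))"
      if "y \<in> carrier A" "e \<in> carrier B" for y e
      using Cons.prems that p ps(1) Cons.IH[of "as @ [a]" y "e \<otimes>\<^bsub>B\<^esub> d"] by simp
  qed (use Cons.prems p module_hom_in[OF h] pure_closed in auto)
  also have "\<dots> = ?h (inB c \<otimes>\<^bsub>S\<^esub> pure x d)"
    using Cons.prems p by (intro sweedler_hom_mult[OF module_M h]) auto
  also have "\<dots> = ten (map inA as @ pure a c # map (\<lambda>(a, b). pure a b) (p # ps))"
    using Cons.prems p asa ps(2) ten_move_right[of "map inA as" a c "pure x d" "map (\<lambda>(a, b). pure a b) ps"]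
    by (simp add: pure_closed)
  finally show ?case .
qed

lemma phi_theta_val:
  assumes "set ps \<subseteq> carrier A \<times> carrier B" "length ps = n"
  shows "theta_val ps \<in> carrier N" and "phi (theta_val ps) = ten (map (\<lambda>(a, b). pure a b) ps)"
proof -
  obtain a b qs where ps: "ps = (a, b) # qs" using assms n_pos by (cases ps) auto
  then show "theta_val ps \<in> carrier N" "phi (theta_val ps) = ten (map (\<lambda>(a, b). pure a b) ps)"
    using assms phi_theta_step[of "[]" a b qs] theta_step_closed[of "[a]" b qs]
    by (auto simp: theta_val_def)
qed

subsection \<open>Compatibility with the actions\<close>

abbreviation "lactN \<equiv> power_times_lact n"
abbreviation "ractN \<equiv> power_times_ract n"

lemma tuples_A_ConsE:
  assumes "as \<in> tuples A n"
  obtains y ys where "as = y # ys" "y \<in> carrier A" "set ys \<subseteq> carrier A" "Suc (length ys) = n"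
  using assms n_pos by (cases as) (auto simp: tuples_def)

lemma tuples_A_snocE:
  assumes "as \<in> tuples A n"
  obtains ys y where "as = ys @ [y]" "y \<in> carrier A" "set ys \<subseteq> carrier A" "Suc (length ys) = n"
  using assms n_pos by (cases as rule: rev_cases) (auto simp: tuples_def)

text \<open>Both actions on \<open>A \<otimes> \<dots> \<otimes> A \<otimes> B\<close> are defined by a linear extension in the element of \<open>S\<close> and one
  in the element of the module. Since \<open>\<phi>\<close> commutes with linear extensions, it is enough to
  compare with the corresponding action \<open>g\<close> on generators.\<close>

lemma phi_intertwines:
  assumes f: "\<And>a b as c. \<lbrakk>a \<in> carrier A; b \<in> carrier B; as \<in> tuples A n; c \<in> carrier B\<rbrakk> \<Longrightarrow>
        f a b as c \<in> carrier N \<and> phi (f a b as c) = g (pure a b) (phi (pten as c))"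
    and g: "\<And>s. s \<in> carrier S \<Longrightarrow> g s \<in> module_hom K M M"
    and g': "\<And>x. x \<in> carrier M \<Longrightarrow> (\<lambda>s. g s x) \<in> module_hom K S M"
    and s: "s \<in> carrier S" and x: "x \<in> carrier N"
    and e: "e = tensor_ext K A B N (\<lambda>a b.
       lin_ext K (tuples A n \<times> carrier B) N (\<lambda>(as, c). f a b as c) x) s"
  shows "e \<in> carrier N \<and> phi e = g s (phi x)"
proof
  have x': "x \<in> carrier PT.P" and s': "s \<in> carrier T" using x s by (simp_all add: N_eq S_simps)
  have c: "lin_ext K (tuples A n \<times> carrier B) N (\<lambda>(as, c). f a b as c) x \<in> carrier N"
    if "a \<in> carrier A" "b \<in> carrier B" for a b
    using that f by (intro PT.lin_ext_closed[OF module_N _ x']) auto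
  then show "e \<in> carrier N" unfolding e by (intro AB.tensor_ext_closed module_N s')
  have phx: "phi x \<in> carrier M" using module_hom_in[OF phi_hom x] .
  have i: "phi (lin_ext K (tuples A n \<times> carrier B) N (\<lambda>(as, c). f a b as c) x) = g (pure a b) (phi x)"
    if ab: "a \<in> carrier A" "b \<in> carrier B" for a b
  proof -
    have gh: "(\<lambda>x. g (pure a b) (phi x)) \<in> module_hom K PT.P M"
      using module_hom_comp[OF phi_hom g[OF pure_closed[OF ab]]] by (simp add: N_eq)
    have "phi (lin_ext K (tuples A n \<times> carrier B) N (\<lambda>(as, c). f a b as c) x)
        = lin_ext K (tuples A n \<times> carrier B) M (\<lambda>y. phi (case y of (as, c) \<Rightarrow> f a b as c)) x"
      using ab f by (intro PT.lin_ext_commute[OF module_N module_M phi_hom _ x']) auto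
    also have "\<dots> = lin_ext K (tuples A n \<times> carrier B) M (\<lambda>y. g (pure a b) (phi (PT.gen y))) x"
      using ab f module_hom_in[OF gh] PT.gen_closed
      by (intro PT.lin_ext_cong[OF module_M _ _ x']) (auto simp: pten_eq)
    also have "\<dots> = g (pure a b) (phi x)"
      using PT.hom_eq_lin_ext[OF module_M gh x'] by simp
    finally show ?thesis .
  qed
  have "phi e = tensor_ext K A B M (\<lambda>a b. phi (lin_ext K (tuples A n \<times> carrier B) N (\<lambda>(as, c). f a b as c) x)) s"
    unfolding e by (intro AB.tensor_ext_commute[OF module_N module_M phi_hom c s'])
  also have "\<dots> = tensor_ext K A B M (\<lambda>a b. g (pure a b) (phi x)) s"
    using i module_hom_in[OF g'[OF phx] pure_closed]
    by (intro AB.tensor_ext_cong[OF module_M _ _ s'])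
  also have "\<dots> = g s (phi x)"
    using AB.hom_eq_tensor_ext[OF module_M, of "\<lambda>s. g s (phi x)"] g'[OF phx] s' by (simp add: module_hom_S)
  finally show "phi e = g s (phi x)" .
qed

lemma phi_lact:
  assumes s: "s \<in> carrier S" and x: "x \<in> carrier N"
  shows "lactN s x \<in> carrier N \<and> phi (lactN s x) = lact s (phi x)"
proof (rule phi_intertwines[OF _ lact_hom lact_hom_scalar s x power_times_lact_def])
  fix a b as c
  assume ab: "a \<in> carrier A" "b \<in> carrier B" and as: "as \<in> tuples A n" and c: "c \<in> carrier B"
  interpret bm: bimodule K S M lact ract by (rule bimodule_M)
  obtain y ys where y: "as = y # ys" "y \<in> carrier A" "set ys \<subseteq> carrier A" "Suc (length ys) = n"
    using as by (rule tuples_A_ConsE)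
  have ys: "set (map inA ys) \<subseteq> carrier S" using map_inA_closed[OF y(3)] .
  let ?h = "\<lambda>s. ract (ten (s # map inA ys)) (inB c)"
  have h: "?h \<in> module_hom K S M"
    using module_hom_comp[OF ten_hom[of "[]" "map inA ys"] ract_hom[OF inB_closed[OF c]]] y(4) ys by simp
  have cl: "push n [a \<otimes>\<^bsub>A\<^esub> z] d ys c \<in> carrier N" if "z \<in> carrier A" "d \<in> carrier B" for z d
    using that ab y c by (intro push_closed) auto
  have "phi (sweedler N (\<lambda>z d. push n [a \<otimes>\<^bsub>A\<^esub> z] d ys c) b y)
      = sweedler M (\<lambda>z d. phi (push n [a \<otimes>\<^bsub>A\<^esub> z] d ys c)) b y"
    by (intro sweedler_commute[OF module_N module_M phi_hom cl] ab y)
  also have "\<dots> = sweedler M (\<lambda>z d. ?h (pure (a \<otimes>\<^bsub>A\<^esub> z) (d \<otimes>\<^bsub>B\<^esub> \<one>\<^bsub>B\<^esub>))) b y"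
  proof (intro sweedler_cong[OF module_M _ _ ab(2) y(2)])
    show "phi (push n [a \<otimes>\<^bsub>A\<^esub> z] d ys c) = ?h (pure (a \<otimes>\<^bsub>A\<^esub> z) (d \<otimes>\<^bsub>B\<^esub> \<one>\<^bsub>B\<^esub>))"
      if "z \<in> carrier A" "d \<in> carrier B" for z d
      using that ab y c phi_push[of "[]" "a \<otimes>\<^bsub>A\<^esub> z" d ys c] by simp
  qed (use ab module_hom_in[OF h] pure_closed in auto)
  also have "\<dots> = ?h (pure a b \<otimes>\<^bsub>S\<^esub> inA y)"
    by (intro sweedler_hom_mult[OF module_M h] ab y B.one_closed)
  also have "\<dots> = ract (lact (pure a b) (ten (map inA as))) (inB c)"
    using ab y ys by (simp add: lact_ten tuples_Cons pure_closed)
  also have "\<dots> = lact (pure a b) (phi (pten as c))"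
    using ab as c by (simp add: bm.lact_ract pure_closed inB_closed ten_closed map_inA_tuples phi_pten phi_gen_def)
  finally show "sweedler N (\<lambda>x\<^sub>\<alpha> b\<^sub>\<alpha>. push n [a \<otimes>\<^bsub>A\<^esub> x\<^sub>\<alpha>] b\<^sub>\<alpha> (tl as) c) b (hd as) \<in> carrier N \<and>
      phi (sweedler N (\<lambda>x\<^sub>\<alpha> b\<^sub>\<alpha>. push n [a \<otimes>\<^bsub>A\<^esub> x\<^sub>\<alpha>] b\<^sub>\<alpha> (tl as) c) b (hd as)) = lact (pure a b) (phi (pten as c))"
    using sweedler_closed[OF module_N cl ab(2) y(2)] y(1) by simp
qed

lemma phi_ract:
  assumes s: "s \<in> carrier S" and x: "x \<in> carrier N"
  shows "ractN x s \<in> carrier N \<and> phi (ractN x s) = ract (phi x) s"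
proof (rule phi_intertwines[OF _ ract_hom ract_hom_scalar s x power_times_ract_def])
  fix a b as c
  assume ab: "a \<in> carrier A" "b \<in> carrier B" and as: "as \<in> tuples A n" and c: "c \<in> carrier B"
  obtain ys y where y: "as = ys @ [y]" "y \<in> carrier A" "set ys \<subseteq> carrier A" "Suc (length ys) = n"
    using as by (rule tuples_A_snocE)
  have ys: "set (map inA ys) \<subseteq> carrier S" using map_inA_closed[OF y(3)] .
  have n1: "n - 1 = length ys" using y(4) by simp
  let ?h = "\<lambda>s. ten (map inA ys @ [s])"
  have h: "?h \<in> module_hom K S M" using ten_hom[of "map inA ys" "[]"] y(4) ys by simp
  have cl: "pten (ys @ [y \<otimes>\<^bsub>A\<^esub> z]) (d \<otimes>\<^bsub>B\<^esub> b) \<in> carrier N" if "z \<in> carrier A" "d \<in> carrier B" for z d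
    using that ab y by (intro pten_closed) (auto simp: tuples_def)
  have "phi (sweedler N (\<lambda>z d. pten (ys @ [y \<otimes>\<^bsub>A\<^esub> z]) (d \<otimes>\<^bsub>B\<^esub> b)) c a)
      = sweedler M (\<lambda>z d. phi (pten (ys @ [y \<otimes>\<^bsub>A\<^esub> z]) (d \<otimes>\<^bsub>B\<^esub> b))) c a"
    by (intro sweedler_commute[OF module_N module_M phi_hom cl] ab c)
  also have "\<dots> = sweedler M (\<lambda>z d. ?h (pure (y \<otimes>\<^bsub>A\<^esub> z) (d \<otimes>\<^bsub>B\<^esub> b))) c a"
  proof (intro sweedler_cong[OF module_M _ _ c ab(1)])
    show "phi (pten (ys @ [y \<otimes>\<^bsub>A\<^esub> z]) (d \<otimes>\<^bsub>B\<^esub> b)) = ?h (pure (y \<otimes>\<^bsub>A\<^esub> z) (d \<otimes>\<^bsub>B\<^esub> b))"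
      if "z \<in> carrier A" "d \<in> carrier B" for z d
      using that ab y by (simp add: phi_pten phi_gen_snoc tuples_def)
  qed (use ab y module_hom_in[OF h] pure_closed in auto)
  also have "\<dots> = ?h (pure y c \<otimes>\<^bsub>S\<^esub> pure a b)"
    by (intro sweedler_hom_mult[OF module_M h] ab y c)
  also have "\<dots> = ract (phi (pten as c)) (pure a b)"
    using ab as c y ys by (simp add: phi_pten phi_gen_snoc ract_ten tuples_snoc pure_closed)
  finally show "sweedler N (\<lambda>a\<^sub>\<alpha> c\<^sub>\<alpha>. pten (as[n - 1 := as ! (n - 1) \<otimes>\<^bsub>A\<^esub> a\<^sub>\<alpha>]) (c\<^sub>\<alpha> \<otimes>\<^bsub>B\<^esub> b)) c a \<in> carrier N \<and>
      phi (sweedler N (\<lambda>a\<^sub>\<alpha> c\<^sub>\<alpha>. pten (as[n - 1 := as ! (n - 1) \<otimes>\<^bsub>A\<^esub> a\<^sub>\<alpha>]) (c\<^sub>\<alpha> \<otimes>\<^bsub>B\<^esub> b)) c a)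
      = ract (phi (pten as c)) (pure a b)"
    using sweedler_closed[OF module_N cl c ab(1)] unfolding n1 by (simp add: y(1))
qed

end

section \<open>Transport of bimodules\<close>

text \<open>A bijective linear map that intertwines given operations on \<open>N\<close> with the actions on a bimodule
  \<open>M\<close> carries the bimodule axioms over to \<open>N\<close>, so only one of the two bimodules has to be checked.
  The intertwining is assumed for \<open>\<phi>\<close>, the direction in which it is easy to prove.\<close>

lemma bimodule_iso_transport:
  assumes M: "bimodule K S M lM rM" and N: "vectorspace K N"
    and th: "\<theta> \<in> module_hom K M N" and ph: "\<phi> \<in> module_hom K N M"
    and pt: "\<And>x. x \<in> carrier M \<Longrightarrow> \<phi> (\<theta> x) = x" and tp: "\<And>y. y \<in> carrier N \<Longrightarrow> \<theta> (\<phi> y) = y"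
    and l: "\<And>s y. \<lbrakk>s \<in> carrier S; y \<in> carrier N\<rbrakk> \<Longrightarrow> lN s y \<in> carrier N \<and> \<phi> (lN s y) = lM s (\<phi> y)"
    and r: "\<And>s y. \<lbrakk>s \<in> carrier S; y \<in> carrier N\<rbrakk> \<Longrightarrow> rN y s \<in> carrier N \<and> \<phi> (rN y s) = rM (\<phi> y) s"
  shows "bimodule_iso K S M lM rM N lN rN \<theta>"
proof -
  interpret M: bimodule K S M lM rM by (rule M)
  note vS = unital_algebra.axioms(1)[OF bimodule.axioms(1)[OF M]] and vM = bimodule.axioms(2)[OF M]
  note mN = vectorspace.axioms(1)[OF N] and mS = vectorspace.axioms(1)[OF vS]
    and mM = vectorspace.axioms(1)[OF vM]
  have lN: "lN s y = \<theta> (lM s (\<phi> y))" if "s \<in> carrier S" "y \<in> carrier N" for s y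
    using l[OF that] tp by metis
  have rN: "rN y s = \<theta> (rM (\<phi> y) s)" if "s \<in> carrier S" "y \<in> carrier N" for s y
    using r[OF that] tp by metis
  have phc: "\<phi> y \<in> carrier M" if "y \<in> carrier N" for y using module_hom_in[OF ph that] .
  have lMc: "lM s x \<in> carrier M" and rMc: "rM x s \<in> carrier M"
    if "s \<in> carrier S" "x \<in> carrier M" for s x
    using that module_hom_in[OF M.lact_hom] module_hom_in[OF M.ract_hom] by blast+
  have "bimodule K S N lN rN"
  proof (intro bimodule.intro bimodule_axioms.intro bimodule.axioms(1)[OF M] N)
    fix s assume s: "s \<in> carrier S"
    show "lN s \<in> module_hom K N N"
      by (rule module_hom_cong[OF mN module_hom_comp[OF module_hom_comp[OF ph M.lact_hom[OF s]] th]])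
        (simp add: lN s)
    show "(\<lambda>x. rN x s) \<in> module_hom K N N"
      by (rule module_hom_cong[OF mN module_hom_comp[OF module_hom_comp[OF ph M.ract_hom[OF s]] th]])
        (simp add: rN s)
  next
    fix y assume y: "y \<in> carrier N"
    show "(\<lambda>s. lN s y) \<in> module_hom K S N"
      by (rule module_hom_cong[OF mS module_hom_comp[OF M.lact_hom_scalar[OF phc[OF y]] th]])
        (simp add: lN y)
    show "rN y \<in> module_hom K S N"
      by (rule module_hom_cong[OF mS module_hom_comp[OF M.ract_hom_scalar[OF phc[OF y]] th]])
        (simp add: rN y)
    show "lN \<one>\<^bsub>S\<^esub> y = y" "rN y \<one>\<^bsub>S\<^esub> = y"
      using y by (simp_all add: lN rN M.lact_one M.ract_one phc tp)
  next
    fix s t y assume *: "s \<in> carrier S" "t \<in> carrier S" "y \<in> carrier N"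
    show "lN (s \<otimes>\<^bsub>S\<^esub> t) y = lN s (lN t y)"
      using * l[of t y] by (simp add: lN[of _ "lN t y"] lN[of "s \<otimes>\<^bsub>S\<^esub> t"] M.lact_assoc phc)
    show "rN y (s \<otimes>\<^bsub>S\<^esub> t) = rN (rN y s) t"
      using * r[of s y] by (simp add: rN[of _ "rN y s"] rN[of "s \<otimes>\<^bsub>S\<^esub> t"] M.ract_assoc phc)
    show "rN (lN s y) t = lN s (rN y t)"
      using * l[of s y] r[of t y] by (simp add: rN[of t "lN s y"] lN[of s "rN y t"] M.lact_ract phc)
  qed
  moreover have "linear_map K M N \<theta>"
    using vM N th mM mN
    by (intro linear_map.intro mod_hom.intro mod_hom_axioms.intro)
  moreover have "bimodule_iso_axioms S M lM rM N lN rN \<theta>"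
  proof (rule bimodule_iso_axioms.intro)
    show "bij_betw \<theta> (carrier M) (carrier N)"
      by (rule bij_betw_byWitness[where f' = \<phi>]) (use pt tp module_hom_in[OF th] phc in auto)
    fix s x assume "s \<in> carrier S" "x \<in> carrier M"
    then show "\<theta> (lM s x) = lN s (\<theta> x)" "\<theta> (rM x s) = rN (\<theta> x) s"
      using module_hom_in[OF th] by (simp_all add: lN rN pt)
  qed
  ultimately show ?thesis
    using M by (intro bimodule_iso.intro)
qed

context factorised_power
begin

section \<open>The map \<open>\<theta>\<close>\<close>

text \<open>\<open>spread [] [s\<^sub>2, \<dots>, s\<^sub>n] s\<^sub>1\<close> is \<open>\<theta>(s\<^sub>1 \<otimes>\<^bsub>B\<^esub> \<dots> \<otimes>\<^bsub>B\<^esub> s\<^sub>n)\<close>. In contrast to \<open>theta_step\<close> it accepts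
  arbitrary elements of \<open>S\<close>, as is needed for a function on the generators of the tensor power.
  The list \<open>as\<close> holds the components already computed, and \<open>s\<close> is the current factor, already
  multiplied by what was left over from the previous ones.\<close>

primrec spread :: "'a list \<Rightarrow> ('a \<times> 'b \<Rightarrow> 'k) set list \<Rightarrow> ('a \<times> 'b \<Rightarrow> 'k) set
    \<Rightarrow> ('a list \<times> 'b \<Rightarrow> 'k) set" where
  "spread as [] s = tensor_ext K A B N (\<lambda>a c. pten (as @ [a]) c) s"
| "spread as (t # ts) s = tensor_ext K A B N (\<lambda>a c. spread (as @ [a]) ts (inB c \<otimes>\<^bsub>S\<^esub> t)) s"

declare spread.simps [simp del]

lemma inB_mult_hom: "t \<in> carrier S \<Longrightarrow> (\<lambda>c. inB c \<otimes>\<^bsub>S\<^esub> t) \<in> module_hom K B S"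
  by (rule module_hom_comp[OF inB_hom mult_hom_S(1)])

lemma zero_in_A: "\<zero>\<^bsub>A\<^esub> \<in> carrier A" by simp

text \<open>The three claims must be proved together. Linearity in \<open>s\<close> rests on bilinearity of the function
  that is extended; this in turn uses linearity in the last entry of \<open>as\<close> and in \<open>s\<close> for the
  shorter list.\<close>

lemma spread_hom:
  "\<lbrakk>set as \<subseteq> carrier A; set ts \<subseteq> carrier S; Suc (length as + length ts) = n\<rbrakk> \<Longrightarrow>
     (case ts of [] \<Rightarrow> bilinear_map K A B N (\<lambda>a c. pten (as @ [a]) c)
      | t # ts' \<Rightarrow> bilinear_map K A B N (\<lambda>a c. spread (as @ [a]) ts' (inB c \<otimes>\<^bsub>S\<^esub> t))) \<and>
     spread as ts \<in> module_hom K S N \<and>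
     (\<forall>i<length as. \<forall>s\<in>carrier S. (\<lambda>a. spread (as[i := a]) ts s) \<in> module_hom K A N)"
proof (induction ts arbitrary: as)
  case Nil
  have as: "as @ [a] \<in> tuples A n" if "a \<in> carrier A" for a using Nil that by (auto simp: tuples_def)
  have b: "bilinear_map K A B N (\<lambda>a c. pten (as @ [a]) c)"
  proof (rule bilinear_mapI)
    show "(\<lambda>a. pten (as @ [a]) c) \<in> module_hom K A N" if "c \<in> carrier B" for c
      using pten_hom_A[OF as[OF zero_in_A], of "length as" c] that Nil by simp
    show "(\<lambda>c. pten (as @ [a]) c) \<in> module_hom K B N" if "a \<in> carrier A" for a
      using pten_hom_B[OF as[OF that]] .
  qed
  moreover have "spread as [] \<in> module_hom K S N"
    using AB.tensor_ext_hom[OF module_N b] by (simp add: module_hom_S spread.simps[abs_def])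
  moreover have "(\<lambda>a. spread (as[i := a]) [] s) \<in> module_hom K A N"
    if i: "i < length as" and s: "s \<in> carrier S" for i s
    unfolding spread.simps
  proof (rule AB.tensor_ext_param[OF module_N])
    show "(\<lambda>u. pten (as[i := u] @ [a]) c) \<in> module_hom K A N" if "a \<in> carrier A" "c \<in> carrier B" for a c
      using pten_hom_A[OF as, of a i c] that i Nil by (simp add: list_update_append)
  qed (use s S_simps in auto)
  ultimately show ?case by simp
next
  case (Cons t ts)
  have as: "set (as @ [a]) \<subseteq> carrier A" "Suc (length (as @ [a]) + length ts) = n" "set ts \<subseteq> carrier S"
    if "a \<in> carrier A" for a using Cons.prems that by auto
  have t: "t \<in> carrier S" using Cons.prems by simp
  have ct: "inB c \<otimes>\<^bsub>S\<^esub> t \<in> carrier S" if "c \<in> carrier B" for c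
    using that t by (intro mult_closed_S inB_closed)
  note IH = Cons.IH[OF as(1,3,2), THEN conjunct2]
  have b: "bilinear_map K A B N (\<lambda>a c. spread (as @ [a]) ts (inB c \<otimes>\<^bsub>S\<^esub> t))"
  proof (rule bilinear_mapI)
    show "(\<lambda>a. spread (as @ [a]) ts (inB c \<otimes>\<^bsub>S\<^esub> t)) \<in> module_hom K A N" if "c \<in> carrier B" for c
      \<comment> \<open>the entry \<open>\<zero>\<close> is a placeholder, which the update replaces by \<open>a\<close>\<close>
      using IH[OF zero_in_A zero_in_A zero_in_A, THEN conjunct2, rule_format, of "length as"] ct[OF that] by simp
    show "(\<lambda>c. spread (as @ [a]) ts (inB c \<otimes>\<^bsub>S\<^esub> t)) \<in> module_hom K B N" if "a \<in> carrier A" for a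
      using module_hom_comp[OF inB_mult_hom[OF t] IH[OF that that that, THEN conjunct1]] .
  qed
  moreover have "spread as (t # ts) \<in> module_hom K S N"
    using AB.tensor_ext_hom[OF module_N b] by (simp add: module_hom_S spread.simps[abs_def])
  moreover have "(\<lambda>a. spread (as[i := a]) (t # ts) s) \<in> module_hom K A N"
    if i: "i < length as" and s: "s \<in> carrier S" for i s
    unfolding spread.simps
  proof (rule AB.tensor_ext_param[OF module_N])
    show "(\<lambda>u. spread (as[i := u] @ [a]) ts (inB c \<otimes>\<^bsub>S\<^esub> t)) \<in> module_hom K A N"
      if "a \<in> carrier A" "c \<in> carrier B" for a c
      using IH[OF that(1) that(1) that(1), THEN conjunct2, rule_format, of i] ct[OF that(2)] i
      by (simp add: list_update_append)
  qed (use s S_simps in auto)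
  ultimately show ?case by simp
qed

lemma spread_hom_S:
  "\<lbrakk>set as \<subseteq> carrier A; set ts \<subseteq> carrier S; Suc (length as + length ts) = n\<rbrakk>
    \<Longrightarrow> spread as ts \<in> module_hom K S N"
  using spread_hom by blast

lemma spread_closed:
  "\<lbrakk>set as \<subseteq> carrier A; set ts \<subseteq> carrier S; Suc (length as + length ts) = n; s \<in> carrier S\<rbrakk>
    \<Longrightarrow> spread as ts s \<in> carrier N"
  using module_hom_in[OF spread_hom_S] .

lemma spread_pure:
  assumes "set as \<subseteq> carrier A" "a \<in> carrier A" "c \<in> carrier B"
  shows "Suc (length as) = n \<Longrightarrow> spread as [] (pure a c) = pten (as @ [a]) c"
    and "\<lbrakk>t \<in> carrier S; set ts \<subseteq> carrier S; Suc (Suc (length as + length ts)) = n\<rbrakk> \<Longrightarrow>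
      spread as (t # ts) (pure a c) = spread (as @ [a]) ts (inB c \<otimes>\<^bsub>S\<^esub> t)"
  using assms spread_hom[of as "[]"] spread_hom[of as "t # ts"]
  by (simp_all add: spread.simps AB.tensor_ext_tens[OF module_N])

lemma spread_slot_hom:
  "\<lbrakk>set as \<subseteq> carrier A; set pre \<subseteq> carrier S; set post \<subseteq> carrier S; s \<in> carrier S;
     Suc (Suc (length as + length pre + length post)) = n\<rbrakk>
    \<Longrightarrow> (\<lambda>x. spread as (pre @ x # post) s) \<in> module_hom K S N"
proof (induction pre arbitrary: as s)
  case Nil
  show ?case unfolding append_Nil spread.simps
  proof (rule AB.tensor_ext_param[OF module_N])
    show "(\<lambda>u. spread (as @ [a]) post (inB c \<otimes>\<^bsub>S\<^esub> u)) \<in> module_hom K S N"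
      if "a \<in> carrier A" "c \<in> carrier B" for a c
      using Nil that by (intro module_hom_comp[OF mult_hom_S(2)[OF inB_closed] spread_hom_S]) auto
  qed (use Nil S_simps in auto)
next
  case (Cons p pre)
  show ?case unfolding append_Cons spread.simps
  proof (rule AB.tensor_ext_param[OF module_N])
    show "(\<lambda>u. spread (as @ [a]) (pre @ u # post) (inB c \<otimes>\<^bsub>S\<^esub> p)) \<in> module_hom K S N"
      if "a \<in> carrier A" "c \<in> carrier B" for a c
      using Cons.prems that by (intro Cons.IH) (auto intro: mult_closed_S inB_closed)
  qed (use Cons S_simps in auto)
qed

text \<open>By linearity \<open>x = a \<otimes> c\<close>, and then both sides continue with \<open>(1 \<otimes> c b) y = (1 \<otimes> c)((1 \<otimes> b) y)\<close>.\<close>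

lemma spread_balanced_head:
  assumes as: "set as \<subseteq> carrier A" and x: "x \<in> carrier S" and b: "b \<in> carrier B"
    and y: "y \<in> carrier S" and ts: "set ts \<subseteq> carrier S" "Suc (Suc (length as + length ts)) = n"
  shows "spread as (y # ts) (x \<otimes>\<^bsub>S\<^esub> inB b) = spread as ((inB b \<otimes>\<^bsub>S\<^esub> y) # ts) x"
proof (rule S_hom_ext[OF module_N _ _ _ x, where h = "\<lambda>x. spread as (y # ts) (x \<otimes>\<^bsub>S\<^esub> inB b)"])
  have bc: "inB b \<in> carrier S" and by': "inB b \<otimes>\<^bsub>S\<^esub> y \<in> carrier S"
    using b y by (simp_all add: inB_closed mult_closed_S)
  show "(\<lambda>x. spread as (y # ts) (x \<otimes>\<^bsub>S\<^esub> inB b)) \<in> module_hom K S N"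
    by (rule module_hom_comp[OF mult_hom_S(1)[OF bc] spread_hom_S]) (use as y ts in auto)
  show "spread as ((inB b \<otimes>\<^bsub>S\<^esub> y) # ts) \<in> module_hom K S N"
    using as by' ts by (intro spread_hom_S) auto
  show "spread as (y # ts) (pure a c \<otimes>\<^bsub>S\<^esub> inB b) = spread as ((inB b \<otimes>\<^bsub>S\<^esub> y) # ts) (pure a c)"
    if "a \<in> carrier A" "c \<in> carrier B" for a c
    using that as b y ts by' bc
    by (simp add: pure_mult_inB spread_pure flip: mult_assoc_S[OF inB_closed bc y])
qed

lemma spread_balanced:
  "\<lbrakk>set as \<subseteq> carrier A; set pre \<subseteq> carrier S; x \<in> carrier S; b \<in> carrier B; y \<in> carrier S;
     set post \<subseteq> carrier S; s \<in> carrier S; Suc (Suc (Suc (length as + length pre + length post))) = n\<rbrakk>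
    \<Longrightarrow> spread as (pre @ (x \<otimes>\<^bsub>S\<^esub> inB b) # y # post) s = spread as (pre @ x # (inB b \<otimes>\<^bsub>S\<^esub> y) # post) s"
proof (induction pre arbitrary: as s)
  case Nil
  show ?case unfolding append_Nil spread.simps(2)[of _ _ "_ # _"]
  proof (rule AB.tensor_ext_cong[OF module_N])
    fix a c assume ac: "a \<in> carrier A" "c \<in> carrier B"
    show "spread (as @ [a]) ((inB b \<otimes>\<^bsub>S\<^esub> y) # post) (inB c \<otimes>\<^bsub>S\<^esub> x) \<in> carrier N"
      using Nil ac by (intro spread_closed) (auto intro: mult_closed_S inB_closed)
    show "spread (as @ [a]) (y # post) (inB c \<otimes>\<^bsub>S\<^esub> (x \<otimes>\<^bsub>S\<^esub> inB b)) =
        spread (as @ [a]) ((inB b \<otimes>\<^bsub>S\<^esub> y) # post) (inB c \<otimes>\<^bsub>S\<^esub> x)"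
      using Nil ac spread_balanced_head[of "as @ [a]" "inB c \<otimes>\<^bsub>S\<^esub> x" b y post]
      by (simp add: mult_closed_S inB_closed mult_assoc_S)
  qed (use Nil S_simps in auto)
next
  case (Cons p pre)
  show ?case unfolding append_Cons spread.simps
  proof (rule AB.tensor_ext_cong[OF module_N])
    fix a c assume ac: "a \<in> carrier A" "c \<in> carrier B"
    show "spread (as @ [a]) (pre @ x # (inB b \<otimes>\<^bsub>S\<^esub> y) # post) (inB c \<otimes>\<^bsub>S\<^esub> p) \<in> carrier N"
      using Cons.prems ac by (intro spread_closed) (auto intro: mult_closed_S inB_closed)
    show "spread (as @ [a]) (pre @ (x \<otimes>\<^bsub>S\<^esub> inB b) # y # post) (inB c \<otimes>\<^bsub>S\<^esub> p) =
        spread (as @ [a]) (pre @ x # (inB b \<otimes>\<^bsub>S\<^esub> y) # post) (inB c \<otimes>\<^bsub>S\<^esub> p)"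
      using Cons.prems ac by (intro Cons.IH) (auto intro: mult_closed_S inB_closed)
  qed (use Cons S_simps in auto)
qed

lemma spread_balanced_multilinear: "balanced_multilinear n N (\<lambda>xs. spread [] (tl xs) (hd xs))"
  unfolding balanced_multilinear_def
proof (intro conjI allI impI; elim conjE)
  fix pre post assume *: "set pre \<subseteq> carrier S" "set post \<subseteq> carrier S" "Suc (length pre + length post) = n"
  then show "(\<lambda>x. spread [] (tl (pre @ x # post)) (hd (pre @ x # post))) \<in> module_hom K S N"
    using spread_hom_S[of "[]" post] spread_slot_hom[of "[]" "tl pre" post "hd pre"] by (cases pre) simp_all
next
  fix pre x b y post
  assume *: "set pre \<subseteq> carrier S" "x \<in> carrier S" "b \<in> carrier B" "y \<in> carrier S"
    "set post \<subseteq> carrier S" "Suc (Suc (length pre + length post)) = n"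
  show "spread [] (tl (pre @ (x \<otimes>\<^bsub>S\<^esub> inB b) # y # post)) (hd (pre @ (x \<otimes>\<^bsub>S\<^esub> inB b) # y # post)) =
    spread [] (tl (pre @ x # (inB b \<otimes>\<^bsub>S\<^esub> y) # post)) (hd (pre @ x # (inB b \<otimes>\<^bsub>S\<^esub> y) # post))"
  proof (cases pre)
    case Nil
    then show ?thesis using * spread_balanced_head[of "[]" x b y post] by simp
  next
    case (Cons p pre')
    then show ?thesis
      using * spread_balanced[of "[]" pre' x b y post p] by simp
  qed
qed

definition theta :: "(('a \<times> 'b \<Rightarrow> 'k) set list \<Rightarrow> 'k) set \<Rightarrow> ('a list \<times> 'b \<Rightarrow> 'k) set" where
  "theta = lin_ext K (tuples S n) N (\<lambda>xs. spread [] (tl xs) (hd xs))"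

lemma theta_hom: "theta \<in> module_hom K M N"
  unfolding theta_def by (intro power_ext_hom module_N spread_balanced_multilinear)

lemma theta_ten: "xs \<in> tuples S n \<Longrightarrow> theta (ten xs) = spread [] (tl xs) (hd xs)"
  unfolding theta_def by (intro power_ext_ten module_N spread_balanced_multilinear)

text \<open>This gives \<open>\<phi> \<circ> \<theta> = id\<close>. For \<open>s = a \<otimes> c\<close> the element \<open>1 \<otimes> c\<close> that was multiplied to the next
  factor is handed back by \<open>ten_move_right\<close>.\<close>

lemma phi_spread:
  "\<lbrakk>set as \<subseteq> carrier A; set ts \<subseteq> carrier S; s \<in> carrier S; Suc (length as + length ts) = n\<rbrakk>
    \<Longrightarrow> phi (spread as ts s) = ten (map inA as @ s # ts)"
proof (induction ts arbitrary: as s)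
  case Nil
  have h: "(\<lambda>s. phi (spread as [] s)) \<in> module_hom K S M"
    using Nil by (intro module_hom_comp[OF spread_hom_S phi_hom]) auto
  have g: "(\<lambda>s. ten (map inA as @ [s])) \<in> module_hom K S M"
    using Nil map_inA_closed by (intro ten_hom) auto
  show ?case
    by (rule S_hom_ext[OF module_M h g])
      (use Nil in \<open>simp_all add: spread_pure phi_pten phi_gen_snoc tuples_def\<close>)
next
  case (Cons t ts)
  have h: "(\<lambda>s. phi (spread as (t # ts) s)) \<in> module_hom K S M"
    using Cons.prems by (intro module_hom_comp[OF spread_hom_S phi_hom]) auto
  have g: "(\<lambda>s. ten (map inA as @ s # t # ts)) \<in> module_hom K S M"
    using Cons.prems map_inA_closed by (intro ten_hom) auto
  show ?case
  proof (rule S_hom_ext[OF module_M h g _ Cons.prems(3)])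
    fix a c assume ac: "a \<in> carrier A" "c \<in> carrier B"
    have "phi (spread as (t # ts) (pure a c)) = phi (spread (as @ [a]) ts (inB c \<otimes>\<^bsub>S\<^esub> t))"
      using Cons.prems ac by (simp add: spread_pure)
    also have "\<dots> = ten (map inA (as @ [a]) @ (inB c \<otimes>\<^bsub>S\<^esub> t) # ts)"
      using Cons.prems ac by (intro Cons.IH) (auto intro: mult_closed_S inB_closed)
    also have "\<dots> = ten (map inA as @ pure a c # t # ts)"
      using Cons.prems ac map_inA_closed[of as] ten_move_right[of "map inA as" a c t ts] by simp
    finally show "phi (spread as (t # ts) (pure a c)) = ten (map inA as @ pure a c # t # ts)" .
  qed
qed

text \<open>This gives \<open>\<theta> \<circ> \<phi> = id\<close>. A tuple in normal form leaves only \<open>1 \<otimes> 1\<close> to be passed on at each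
  step.\<close>

lemma spread_inA:
  "\<lbrakk>set as \<subseteq> carrier A; set xs \<subseteq> carrier A; a \<in> carrier A; b \<in> carrier B;
     Suc (length as + length xs) = n; s # ts = map inA xs @ [pure a b]\<rbrakk>
    \<Longrightarrow> spread as ts s = pten (as @ xs @ [a]) b"
proof (induction xs arbitrary: as s ts)
  case Nil
  then show ?case by (simp add: spread_pure)
next
  case (Cons x xs)
  interpret SA: unital_algebra K S by (rule unital_algebra_S)
  obtain t us where t: "map inA xs @ [pure a b] = t # us" by (cases "map inA xs @ [pure a b]") auto
  have "set (t # us) \<subseteq> carrier S"
    unfolding t[symmetric] using Cons.prems map_inA_closed[of xs] pure_closed by auto
  moreover have "length (t # us) = Suc (length xs)" unfolding t[symmetric] by simp
  ultimately have "spread as (t # us) (inA x) = spread (as @ [x]) us (inB \<one>\<^bsub>B\<^esub> \<otimes>\<^bsub>S\<^esub> t)"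
    using Cons.prems by (intro spread_pure) auto
  also have "\<dots> = spread (as @ [x]) us t"
    using \<open>set (t # us) \<subseteq> carrier S\<close> SA.l_one[of t] by (simp add: S_simps(5))
  also have "\<dots> = pten ((as @ [x]) @ xs @ [a]) b"
    using Cons.prems t by (intro Cons.IH) auto
  finally show ?case using Cons.prems(6) t by simp
qed

lemma phi_theta: "x \<in> carrier M \<Longrightarrow> phi (theta x) = x"
proof (rule power_hom_ext[OF module_M module_hom_comp[OF theta_hom phi_hom] id_hom_M])
  fix xs assume "xs \<in> tuples S n"
  then show "phi (theta (ten xs)) = ten xs"
    using phi_spread[of "[]" "tl xs" "hd xs"] by (elim tuples_ConsE) (simp add: theta_ten tuples_Cons)
qed

lemma theta_ten_pure:
  assumes "set xs \<subseteq> carrier A" "a \<in> carrier A" "b \<in> carrier B" "Suc (length xs) = n"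
  shows "theta (ten (map inA xs @ [pure a b])) = pten (xs @ [a]) b"
proof -
  obtain t ts where t: "map inA xs @ [pure a b] = t # ts" by (cases "map inA xs @ [pure a b]") auto
  have "map inA xs @ [pure a b] \<in> tuples S n"
    using assms map_inA_closed[of xs] by (simp add: tuples_snoc pure_closed)
  then show ?thesis using spread_inA[of "[]" xs a b t ts] assms t by (simp add: theta_ten)
qed

lemma theta_phi: "y \<in> carrier N \<Longrightarrow> theta (phi y) = y"
proof -
  have id: "(\<lambda>y. y) \<in> module_hom K PT.P N" by (rule module_homI) (simp_all add: N_eq)
  have tp: "(\<lambda>y. theta (phi y)) \<in> module_hom K PT.P N"
    using module_hom_comp[OF phi_hom theta_hom] by (simp add: N_eq)
  show "theta (phi y) = y" if "y \<in> carrier N"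
  proof (rule PT.hom_ext[OF module_N tp id])
    fix x assume "x \<in> tuples A n \<times> carrier B"
    then obtain as b where x: "x = (as, b)" "as \<in> tuples A n" "b \<in> carrier B" by auto
    from x(2) obtain ys a where "as = ys @ [a]" "a \<in> carrier A" "set ys \<subseteq> carrier A" "Suc (length ys) = n"
      by (rule tuples_A_snocE)
    with x show "theta (phi (PT.gen x)) = PT.gen x"
      by (simp add: phi_pten phi_gen_snoc theta_ten_pure flip: pten_eq)
  qed (use that N_eq in simp)
qed

lemma bimodule_iso_theta: "bimodule_iso K S M lact ract N lactN ractN theta"
  by (rule bimodule_iso_transport[OF bimodule_M vectorspace_N theta_hom phi_hom phi_theta theta_phi
        phi_lact phi_ract])

lemma theta_theta_val:
  assumes "set ps \<subseteq> carrier A \<times> carrier B" "length ps = n"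
  shows "theta (ten (map (\<lambda>(a, b). pure a b) ps)) = theta_val ps"
  using phi_theta_val[OF assms] theta_phi[of "theta_val ps"] by simp

end

theorem theorem3p3:
  fixes K :: "('k, 'r) ring_scheme"
    and A :: "('k, 'a, 's) module_scheme"
    and B :: "('k, 'b, 't) module_scheme"
    and \<psi> :: "('b \<times> 'a \<Rightarrow> 'k) set \<Rightarrow> ('a \<times> 'b \<Rightarrow> 'k) set"
    and n :: nat
  assumes "field K"
    and char_zero: "\<And>m::nat. m \<ge> 1 \<Longrightarrow> [m] \<cdot>\<^bsub>K\<^esub> \<one>\<^bsub>K\<^esub> \<noteq> \<zero>\<^bsub>K\<^esub>"
    and "unital_algebra K A" and "vectorspace.fin_dim K A"
    and "unital_algebra K B" and "vectorspace.fin_dim K B"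
    and "factorisation_data.factorisation K A B \<psi>"
    and "n \<ge> 1"
  shows "\<exists>\<theta>.
    bimodule_iso K (factorisation_data.fact_alg K A B \<psi>)
      (factorisation_data.fact_power K A B \<psi> n)
      (factorisation_data.fact_power_lact K A B \<psi> n)
      (factorisation_data.fact_power_ract K A B \<psi> n)
      (factorisation_data.power_times K A B n)
      (factorisation_data.power_times_lact K A B \<psi> n)
      (factorisation_data.power_times_ract K A B \<psi> n)
      \<theta> \<and>
    (\<forall>ps. ps \<in> lists (carrier A \<times> carrier B) \<and> length ps = n \<longrightarrow>
      \<theta> (factorisation_data.fact_power_tens K A B \<psi> n (map (\<lambda>(a, b). tens K A B a b) ps)) =
        factorisation_data.theta_val K A B \<psi> ps) \<and>
    (\<forall>as b. as \<in> lists (carrier A) \<and> length as = n \<and> b \<in> carrier B \<longrightarrow>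
      inv_into (carrier (factorisation_data.fact_power K A B \<psi> n)) \<theta>
        (factorisation_data.power_times_tens K A B n as b) =
      factorisation_data.fact_power_tens K A B \<psi> n
        (map (\<lambda>a. tens K A B a \<one>\<^bsub>B\<^esub>) (butlast as) @ [tens K A B (last as) b]))"
proof -
  interpret factorised_power K A B \<psi> n
    using assms
    by (intro factorised_power.intro factorised.intro factorised_axioms.intro factorised_power_axioms.intro)
  interpret iso: bimodule_iso K S M lact ract N lactN ractN theta by (rule bimodule_iso_theta)
  have inv: "inv_into (carrier M) theta (pten as b) = ten (map inA (butlast as) @ [pure (last as) b])"
    if "set as \<subseteq> carrier A" "length as = n" "b \<in> carrier B" for as b
  proof -
    from that(1,2) obtain xs a where as: "as = xs @ [a]"
      using n_pos by (cases as rule: rev_cases) auto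
    have c: "ten (map inA xs @ [pure a b]) \<in> carrier M"
      using that as map_inA_closed[of xs] by (intro ten_closed) (simp add: tuples_snoc pure_closed)
    have "theta (ten (map inA xs @ [pure a b])) = pten as b"
      using that as by (simp add: theta_ten_pure)
    then show ?thesis
      using inv_into_f_f[OF bij_betw_imp_inj_on[OF iso.bij] c] as by simp
  qed
  show ?thesis
    using bimodule_iso_theta theta_theta_val inv
    by (intro exI[of _ theta] conjI allI impI) (auto simp: lists_eq_set)
qed

end
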